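(* Let $X$ be a complex Banach space and $T\in\mathcal{B}(X)$. Then $\sigma_{gD\mathcal{M}}(T)=\sigma_{gD\mathcal{W}+}(T)$ if and only if $T$ has SVEP at every $\lambda\notin\sigma_{gD\mathcal{W}+}(T)$.
   Context: $\mathcal{B}(X)$ is the algebra of bounded linear operators on $X$. $(M,N)\in Red(T)$ means that $M,N$ are closed $T$-invariant subspaces with $X=M\oplus N$. $T$ is upper semi-Fredholm if $\dim N(T)<\infty$ and $R(T)$ is closed ($N(T)$, $R(T)$ being kernel and range), with index $ind(T)=\dim N(T)-\operatorname{codim}R(T)$. $T$ is generalized Drazin bounded below (resp. generalized Drazin upper semi-Weyl) if there exists $(M,N)\in Red(T)$ such that $T_{|M}$ is bounded below (resp. upper semi-Fredholm with index $\le 0$) and $T_{|N}$ is quasi-nilpotent. $\sigma_{gD\mathcal{M}}(T)$ (resp. $\sigma_{gD\mathcal{W}+}(T)$) is the set of $\lambda\in\mathbb{C}$ such that $T-\lambda I$ is not generalized Drazin bounded below (resp. not generalized Drazin upper semi-Weyl). $T$ has SVEP (the single valued extension property) at $\lambda_0\in\mathbb{C}$ if for every connected open neighbourhood $U$ of $\lambda_0$ the only analytic function $f:U\to X$ with $(T-zI)f(z)=0$ for all $z\in U$ is $f\equiv 0$. *)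

theory Defs
  imports "HOL-Analysis.Analysis"
begin

section \<open>Complex Banach spaces\<close>

class complex_banach = banach +
  fixes scaleC :: "complex \<Rightarrow> 'a \<Rightarrow> 'a"  (infixr \<open>*\<^sub>C\<close> 75)
  assumes scaleC_add_right: "a *\<^sub>C (x + y) = a *\<^sub>C x + a *\<^sub>C y"
    and scaleC_add_left: "(a + b) *\<^sub>C x = a *\<^sub>C x + b *\<^sub>C x"
    and scaleC_scaleC: "a *\<^sub>C (b *\<^sub>C x) = (a * b) *\<^sub>C x"
    and scaleC_of_real: "complex_of_real r *\<^sub>C x = r *\<^sub>R x"
    and norm_scaleC: "norm (a *\<^sub>C x) = cmod a * norm x"

interpretation complex_vector:
  vector_space "scaleC :: complex \<Rightarrow> 'a \<Rightarrow> 'a::complex_banach"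
proof
  fix x :: 'a
  show "1 *\<^sub>C x = x"
    using scaleC_of_real[of 1 x] by simp
qed (simp_all add: scaleC_add_right scaleC_add_left scaleC_scaleC)

text \<open>The elements of \<open>\<B>(X)\<close> are represented as functions satisfying this predicate.\<close>

definition bounded_clinear :: "('a::complex_banach \<Rightarrow> 'a) \<Rightarrow> bool" where
  "bounded_clinear T \<longleftrightarrow> bounded_linear T \<and> (\<forall>c x. T (c *\<^sub>C x) = c *\<^sub>C T x)"

definition closed_csubspace :: "'a::complex_banach set \<Rightarrow> bool" where
  "closed_csubspace M \<longleftrightarrow> complex_vector.subspace M \<and> closed M"

definition Red :: "('a::complex_banach \<Rightarrow> 'a) \<Rightarrow> ('a set \<times> 'a set) set" where
  "Red T = {(M, N). closed_csubspace M \<and> closed_csubspace N \<and>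
     T ` M \<subseteq> M \<and> T ` N \<subseteq> N \<and>
     M \<inter> N = {0} \<and> (\<forall>x. \<exists>m\<in>M. \<exists>n\<in>N. x = m + n)}"

section \<open>Dimension, codimension and index\<close>

definition ext_dim :: "'a::complex_banach set \<Rightarrow> enat" where
  "ext_dim V = (if \<exists>B. finite B \<and> V \<subseteq> complex_vector.span B
                then enat (complex_vector.dim V) else \<infinity>)"

text \<open>\<open>B\<close> is a finite set of vectors of \<open>V\<close> whose classes are distinct and form a basis of
  the quotient space \<open>V / W\<close>.\<close>

definition finite_basis_mod :: "'a::complex_banach set \<Rightarrow> 'a set \<Rightarrow> 'a set \<Rightarrow> bool" where
  "finite_basis_mod V W B \<longleftrightarrow> finite B \<and> B \<subseteq> V \<and>
     (\<forall>c. (\<Sum>b\<in>B. c b *\<^sub>C b) \<in> W \<longrightarrow> (\<forall>b\<in>B. c b = 0)) \<and>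
     V \<subseteq> complex_vector.span (W \<union> B)"

text \<open>The dimension of \<open>V / W\<close>. All finite bases have the same cardinality, so the infimum only
  selects this common value; it is \<open>\<infinity>\<close> if there is no finite basis.\<close>

definition ext_codim :: "'a::complex_banach set \<Rightarrow> 'a set \<Rightarrow> enat" where
  "ext_codim V W = (INF B \<in> {B. finite_basis_mod V W B}. enat (card B))"

text \<open>In the remaining definitions a property \<open>P_on M T\<close> is the property \<open>P\<close> of the restriction
  \<open>T\<^bsub>|M\<^esub>\<close> as an operator on \<open>M\<close>, for a closed \<open>T\<close>-invariant subspace \<open>M\<close>. A subset of such an \<open>M\<close>
  is closed in \<open>M\<close> iff it is closed in the whole space.\<close>

definition kernel_on :: "'a::complex_banach set \<Rightarrow> ('a \<Rightarrow> 'a) \<Rightarrow> 'a set" where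
  "kernel_on M T = {x \<in> M. T x = 0}"

text \<open>Only meaningful for a finite-dimensional kernel; it is \<open>-\<infinity>\<close> if the range then has infinite
  codimension.\<close>

definition index_on :: "'a::complex_banach set \<Rightarrow> ('a \<Rightarrow> 'a) \<Rightarrow> ereal" where
  "index_on M T = ereal_of_enat (ext_dim (kernel_on M T)) - ereal_of_enat (ext_codim M (T ` M))"

section \<open>Classes of operators\<close>

definition bounded_below_on :: "'a::complex_banach set \<Rightarrow> ('a \<Rightarrow> 'a) \<Rightarrow> bool" where
  "bounded_below_on M T \<longleftrightarrow> (\<exists>c>0. \<forall>x\<in>M. c * norm x \<le> norm (T x))"

definition upper_semi_Fredholm_on :: "'a::complex_banach set \<Rightarrow> ('a \<Rightarrow> 'a) \<Rightarrow> bool" where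
  "upper_semi_Fredholm_on M T \<longleftrightarrow> ext_dim (kernel_on M T) < \<infinity> \<and> closed (T ` M)"

text \<open>Existence of an inverse \<open>S\<close> in \<open>\<B>(N)\<close>.\<close>

definition invertible_on :: "'a::complex_banach set \<Rightarrow> ('a \<Rightarrow> 'a) \<Rightarrow> bool" where
  "invertible_on N A \<longleftrightarrow> (\<exists>S.
     S ` N \<subseteq> N \<and>
     (\<forall>x\<in>N. \<forall>y\<in>N. S (x + y) = S x + S y) \<and>
     (\<forall>c. \<forall>x\<in>N. S (c *\<^sub>C x) = c *\<^sub>C S x) \<and>
     (\<exists>K. \<forall>x\<in>N. norm (S x) \<le> K * norm x) \<and>
     (\<forall>x\<in>N. S (A x) = x \<and> A (S x) = x))"

definition spectrum_on :: "'a::complex_banach set \<Rightarrow> ('a \<Rightarrow> 'a) \<Rightarrow> complex set" where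
  "spectrum_on N T = {z. \<not> invertible_on N (\<lambda>x. T x - z *\<^sub>C x)}"

text \<open>Inclusion rather than equality, since the spectrum is empty for \<open>N = {0}\<close>.\<close>

definition quasi_nilpotent_on :: "'a::complex_banach set \<Rightarrow> ('a \<Rightarrow> 'a) \<Rightarrow> bool" where
  "quasi_nilpotent_on N T \<longleftrightarrow> spectrum_on N T \<subseteq> {0}"

definition gD_bounded_below :: "('a::complex_banach \<Rightarrow> 'a) \<Rightarrow> bool" where
  "gD_bounded_below T \<longleftrightarrow>
     (\<exists>(M, N) \<in> Red T. bounded_below_on M T \<and> quasi_nilpotent_on N T)"

definition gD_upper_semi_Weyl :: "('a::complex_banach \<Rightarrow> 'a) \<Rightarrow> bool" where
  "gD_upper_semi_Weyl T \<longleftrightarrow>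
     (\<exists>(M, N) \<in> Red T. upper_semi_Fredholm_on M T \<and> index_on M T \<le> 0 \<and> quasi_nilpotent_on N T)"

definition sigma_gDM :: "('a::complex_banach \<Rightarrow> 'a) \<Rightarrow> complex set" where
  "sigma_gDM T = {z. \<not> gD_bounded_below (\<lambda>x. T x - z *\<^sub>C x)}"

definition sigma_gDWplus :: "('a::complex_banach \<Rightarrow> 'a) \<Rightarrow> complex set" where
  "sigma_gDWplus T = {z. \<not> gD_upper_semi_Weyl (\<lambda>x. T x - z *\<^sub>C x)}"

section \<open>The single valued extension property\<close>

text \<open>Complex differentiability at every point of an open set \<open>U\<close>: the derivative at \<open>z\<close> is
  \<open>h \<mapsto> h D\<close> with \<open>D\<close> in the space. The library's \<^const>\<open>holomorphic_on\<close> only covers functions with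
  values in a field.\<close>

definition analytic_vec_on :: "(complex \<Rightarrow> 'a::complex_banach) \<Rightarrow> complex set \<Rightarrow> bool" where
  "analytic_vec_on f U \<longleftrightarrow> (\<forall>z\<in>U. \<exists>D. (f has_derivative (\<lambda>h. h *\<^sub>C D)) (at z))"

definition SVEP_at :: "('a::complex_banach \<Rightarrow> 'a) \<Rightarrow> complex \<Rightarrow> bool" where
  "SVEP_at T z0 \<longleftrightarrow>
     (\<forall>U f. open U \<and> connected U \<and> z0 \<in> U \<and> analytic_vec_on f U \<and>
        (\<forall>z\<in>U. T (f z) - z *\<^sub>C f z = 0) \<longrightarrow> (\<forall>z\<in>U. f z = 0))"

end

theory Submission
  imports Defs "HOL-Complex_Analysis.Conformal_Mappings"
begin

text \<open>
  The two spectra are compared point by point; replacing \<open>T\<close> by \<open>T - \<lambda>I\<close>, take \<open>\<lambda> = 0\<close>.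
  An operator that is bounded below is injective with closed range, hence upper semi-Fredholm with
  nonpositive index, so one inclusion between the spectra always holds. The equivalence then says
  that, for a generalized Drazin upper semi-Weyl operator, SVEP at \<open>0\<close> is the same as being
  generalized Drazin bounded below.

  \<^emph>\<open>Bounded below implies SVEP.\<close> For small \<open>z \<noteq> 0\<close> the operator \<open>T - z\<close> is injective on both summands
  of the decomposition. A solution \<open>f\<close> of \<open>(T - z) f z = 0\<close> thus vanishes near \<open>0\<close>, and then
  everywhere by the identity theorem, which passes from scalar to vector-valued functions by means
  of continuous functionals (\<open>SVEP_if_gD_bounded_below\<close>).

  \<^emph>\<open>SVEP implies bounded below.\<close> Let \<open>X = M \<oplus> N\<close> with \<open>T\<close> upper semi-Fredholm on \<open>M\<close>. All ranges
  \<open>R\<^sub>n = T\<^sup>n M\<close> are closed, and finite-dimensionality of the kernel gives \<open>T R = R\<close> for their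
  intersection \<open>R\<close>. If the kernel contained an element \<open>e \<noteq> 0\<close> of \<open>R\<close>, the open mapping theorem
  would give \<open>x\<^sub>0 = e\<close>, \<open>T x\<^bsub>n+1\<^esub> = x\<^sub>n\<close> with \<open>\<parallel>x\<^sub>n\<parallel> \<le> C\<^sup>n \<parallel>e\<parallel>\<close>, and \<open>\<Sum>n. z\<^sup>n x\<^sub>n\<close> would violate SVEP
  (\<open>SVEP_injective_if_surjective\<close>). So each \<open>e \<noteq> 0\<close> in the kernel is \<open>T\<^sup>n y\<close> for some \<open>n\<close> but lies outside
  the closed subspace \<open>R\<^bsub>n+1\<^esub>\<close>. A functional separating \<open>e\<close> from \<open>R\<^bsub>n+1\<^esub>\<close> yields a closed invariant
  complement in \<open>M\<close> of the span of \<open>y, T y, \<dots>, T\<^sup>n y\<close> (\<open>split_off_Jordan_chain\<close>). On this span \<open>T\<close>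
  is nilpotent, so it can be moved from \<open>M\<close> to \<open>N\<close>; the kernel on \<open>M\<close> loses a dimension. After
  finitely many steps \<open>T\<close> is injective with closed range on \<open>M\<close>, that is, bounded below
  (\<open>gD_bounded_below_if_SVEP\<close>).
\<close>

section \<open>Complex subspaces and bounded complex-linear operators\<close>

lemma bounded_linear_scaleC_right: "bounded_linear (\<lambda>x::'a::complex_banach. c *\<^sub>C x)"
proof (rule bounded_linear_intro)
  show "c *\<^sub>C (r *\<^sub>R x) = r *\<^sub>R (c *\<^sub>C x)" for r and x :: 'a
    by (simp add: scaleC_scaleC mult.commute flip: scaleC_of_real)
  show "norm (c *\<^sub>C x) \<le> norm x * cmod c" for x :: 'a
    by (simp add: norm_scaleC mult.commute)
qed (simp add: scaleC_add_right)

lemma bounded_linear_scaleC_left: "bounded_linear (\<lambda>c. c *\<^sub>C (x::'a::complex_banach))"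
proof (rule bounded_linear_intro)
  show "norm (c *\<^sub>C x) \<le> norm c * norm x" for c by (simp add: norm_scaleC)
  show "(r *\<^sub>R c) *\<^sub>C x = r *\<^sub>R (c *\<^sub>C x)" for r c
    by (simp add: scaleR_conv_of_real scaleC_scaleC flip: scaleC_of_real)
qed (simp add: scaleC_add_left)

lemma csubspace_imp_subspace: "complex_vector.subspace L \<Longrightarrow> subspace L"
  unfolding complex_vector.subspace_def subspace_def by (metis scaleC_of_real)

lemma bounded_clinear_bounded_linear: "bounded_clinear T \<Longrightarrow> bounded_linear T"
  and bounded_clinear_scaleC: "bounded_clinear T \<Longrightarrow> T (c *\<^sub>C x) = c *\<^sub>C T x"
  by (simp_all add: bounded_clinear_def)

lemma bounded_clinear_add: "bounded_clinear T \<Longrightarrow> T (x + y) = T x + T y"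
  and bounded_clinear_diff: "bounded_clinear T \<Longrightarrow> T (x - y) = T x - T y"
  and bounded_clinear_zero: "bounded_clinear T \<Longrightarrow> T 0 = 0"
  using bounded_clinear_bounded_linear
  by (auto intro: linear_add linear_diff linear_0 dest!: bounded_linear.linear)

lemmas bounded_clinear_simps =
  bounded_clinear_scaleC bounded_clinear_add bounded_clinear_diff bounded_clinear_zero

lemma bounded_clinear_funpow:
  assumes "bounded_clinear T"
  shows "bounded_clinear (T ^^ n)"
proof (induction n)
  case 0
  then show ?case by (simp add: bounded_clinear_def id_def)
next
  case (Suc n)
  then show ?case
    using assms by (auto simp: bounded_clinear_def o_def intro: bounded_linear_compose)
qed

lemma bounded_clinear_diff_scaleC:
  assumes "bounded_clinear T"
  shows "bounded_clinear (\<lambda>x. T x - z *\<^sub>C x)"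
  using assms
  by (auto simp: bounded_clinear_def scaleC_scaleC mult.commute complex_vector.scale_right_diff_distrib
      intro!: bounded_linear_sub bounded_linear_scaleC_right)

lemma csubspace_image:
  assumes T: "bounded_clinear T" and M: "complex_vector.subspace M"
  shows "complex_vector.subspace (T ` M)"
proof (rule complex_vector.subspaceI)
  show "0 \<in> T ` M"
    using bounded_clinear_zero[OF T] complex_vector.subspace_0[OF M] by force
  show "x + y \<in> T ` M" if "x \<in> T ` M" "y \<in> T ` M" for x y
    using that bounded_clinear_add[OF T, symmetric] complex_vector.subspace_add[OF M] by auto
  show "c *\<^sub>C x \<in> T ` M" if "x \<in> T ` M" for c x
    using that bounded_clinear_scaleC[OF T, symmetric] complex_vector.subspace_scale[OF M] by auto
qed

lemma csubspace_kernel_on: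
  assumes T: "bounded_clinear T" and M: "complex_vector.subspace M"
  shows "complex_vector.subspace (kernel_on M T)"
  using M unfolding complex_vector.subspace_def kernel_on_def
  by (auto simp: bounded_clinear_simps[OF T])

lemma csubspace_vimage:
  assumes T: "bounded_clinear T" and S: "complex_vector.subspace S"
  shows "complex_vector.subspace (T -` S)"
  using S unfolding complex_vector.subspace_def by (auto simp: bounded_clinear_simps[OF T])

section \<open>The Hahn-Banach theorem\<close>

text \<open>Zorn's lemma is applied to graphs: a linear functional on a subspace is a subspace of
  \<open>X \<times> \<real>\<close>, and domination by the norm already forces such a subspace to be single-valued,
  so single-valuedness need not be checked for the union of a chain.\<close>

lemma dominated_functional_extension:
  fixes G0 :: "('a::real_normed_vector \<times> real) set"
  assumes G0: "subspace G0" and K: "K \<ge> 0" and dom: "\<And>x a. (x, a) \<in> G0 \<Longrightarrow> a \<le> K * norm x"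
  obtains \<psi> :: "'a \<Rightarrow> real" where "bounded_linear \<psi>" "\<And>x a. (x, a) \<in> G0 \<Longrightarrow> \<psi> x = a"
proof -
  define A where "A = {G. subspace G \<and> G0 \<subseteq> G \<and> (\<forall>x a. (x, a) \<in> G \<longrightarrow> a \<le> K * norm x)}"
  have "\<exists>G\<in>A. \<forall>H\<in>A. G \<subseteq> H \<longrightarrow> H = G"
  proof (rule subset_Zorn_nonempty)
    show "A \<noteq> {}"
      using assms by (auto simp: A_def)
  next
    fix C assume "C \<noteq> {}" and ch: "subset.chain A C"
    then obtain H0 where H0: "H0 \<in> C" by blast
    have CA: "\<And>H. H \<in> C \<Longrightarrow> H \<in> A" and tot: "\<And>H H'. H \<in> C \<Longrightarrow> H' \<in> C \<Longrightarrow> H \<subseteq> H' \<or> H' \<subseteq> H"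
      using ch by (auto simp: subset_chain_def)
    have "subspace (\<Union>C)"
    proof (rule subspaceI)
      show "0 \<in> \<Union>C"
        using CA[OF H0] H0 by (auto simp: A_def intro: subspace_0)
      show "c *\<^sub>R p \<in> \<Union>C" if "p \<in> \<Union>C" for c p
        using that CA by (auto simp: A_def intro: subspace_scale)
      show "p + q \<in> \<Union>C" if pq: "p \<in> \<Union>C" "q \<in> \<Union>C" for p q
      proof -
        obtain H H' where H: "H \<in> C" "p \<in> H" "H' \<in> C" "q \<in> H'" using pq by blast
        with tot[of H H'] obtain H'' where "H'' \<in> C" "p \<in> H''" "q \<in> H''" by blast
        then show ?thesis
          using CA[of H''] by (auto simp: A_def intro: subspace_add)
      qed
    qed
    then show "\<Union>C \<in> A"
      using CA H0 by (fastforce simp: A_def)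
  qed
  then obtain G where "G \<in> A" and max: "\<And>H. H \<in> A \<Longrightarrow> G \<subseteq> H \<Longrightarrow> H = G" by blast
  then have G: "subspace G" "G0 \<subseteq> G" and domG: "\<And>x a. (x, a) \<in> G \<Longrightarrow> a \<le> K * norm x"
    by (auto simp: A_def)
  have add: "(x + y, a + b) \<in> G" if "(x, a) \<in> G" "(y, b) \<in> G" for x y a b
    using subspace_add[OF G(1) that] by simp
  have scale: "(r *\<^sub>R x, r * a) \<in> G" if "(x, a) \<in> G" for x a r
    using subspace_scale[OF G(1) that, of r] by simp
  have zero: "(0, 0) \<in> G"
    using subspace_0[OF G(1)] by (simp add: zero_prod_def)
  have sv: "a = b" if "(x, a) \<in> G" "(x, b) \<in> G" for x a b
    using domG[OF add[OF that(1) scale[OF that(2), of "-1"]]]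
      domG[OF add[OF that(2) scale[OF that(1), of "-1"]]] by simp
  have total: "\<exists>a. (x, a) \<in> G" for x
  proof -
    define L where "L = {b - K * norm (y - x) | y b. (y, b) \<in> G}"
    \<comment> \<open>The value at \<open>x\<close> must lie above \<open>L\<close> and below the upper bounds of \<open>L\<close> that the triangle
      inequality provides; the supremum of \<open>L\<close> is such a value.\<close>
    have LU: "b - K * norm (y - x) \<le> K * norm (y' + x) - b'"
      if "(y, b) \<in> G" "(y', b') \<in> G" for y b y' b'
    proof -
      have "norm (y + y') \<le> norm (y - x) + norm (y' + x)"
        using norm_triangle_ineq[of "y - x" "y' + x"] by simp
      then have "K * norm (y + y') \<le> K * (norm (y - x) + norm (y' + x))"
        using K by (intro mult_left_mono)
      with domG[OF add[OF that]] show ?thesis by (simp add: algebra_simps)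
    qed
    define a where "a = Sup L"
    have ne: "L \<noteq> {}" and bdd: "bdd_above L"
      using zero LU[OF _ zero] by (auto simp: L_def bdd_above_def)
    have lower: "b - K * norm (y - x) \<le> a" if "(y, b) \<in> G" for y b
      unfolding a_def using that bdd by (intro cSup_upper) (auto simp: L_def)
    have upper: "a \<le> K * norm (y + x) - b" if "(y, b) \<in> G" for y b
      unfolding a_def using that ne LU by (intro cSup_least) (auto simp: L_def)
    define H where "H = {(y + s *\<^sub>R x, b + s * a) | y b s. (y, b) \<in> G}"
    have "subspace H"
    proof (rule subspaceI)
      show "0 \<in> H"
        using zero unfolding H_def zero_prod_def by force
      show "p + q \<in> H" if pq: "p \<in> H" "q \<in> H" for p q
      proof -
        obtain y b s y' b' s' where p: "p = (y + s *\<^sub>R x, b + s * a)" "(y, b) \<in> G"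
          and q: "q = (y' + s' *\<^sub>R x, b' + s' * a)" "(y', b') \<in> G"
          using pq by (auto simp: H_def)
        have "p + q = ((y + y') + (s + s') *\<^sub>R x, (b + b') + (s + s') * a)"
          by (simp add: p q algebra_simps)
        then show ?thesis using add[OF p(2) q(2)] unfolding H_def by blast
      qed
      show "c *\<^sub>R p \<in> H" if pp: "p \<in> H" for c p
      proof -
        obtain y b s where p: "p = (y + s *\<^sub>R x, b + s * a)" "(y, b) \<in> G"
          using pp by (auto simp: H_def)
        have "c *\<^sub>R p = (c *\<^sub>R y + (c * s) *\<^sub>R x, c * b + (c * s) * a)"
          by (simp add: p algebra_simps)
        then show ?thesis using scale[OF p(2), of c] unfolding H_def by blast
      qed
    qed
    moreover have "b + s * a \<le> K * norm (y + s *\<^sub>R x)" if "(y, b) \<in> G" for y b s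
    proof -
      consider "s = 0" | "s > 0" | "s < 0" by linarith
      then show ?thesis
      proof cases
        case 1 then show ?thesis using domG[OF that] by simp
      next
        case 2
        have "s * a \<le> s * (K * norm (inverse s *\<^sub>R y + x) - inverse s * b)"
          using upper[OF scale[OF that, of "inverse s"]] 2 by (intro mult_left_mono) auto
        also have "\<dots> = K * norm (s *\<^sub>R (inverse s *\<^sub>R y + x)) - b"
          using 2 by (simp add: algebra_simps del: scaleR_right_distrib)
        finally show ?thesis using 2 by (simp add: algebra_simps)
      next
        case 3
        define t where "t = - s"
        have t: "t > 0" "s = - t" using 3 by (auto simp: t_def)
        have "t * (inverse t * b - K * norm (inverse t *\<^sub>R y - x)) \<le> t * a"
          using lower[OF scale[OF that, of "inverse t"]] t by (intro mult_left_mono) auto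
        also have "t * (inverse t * b - K * norm (inverse t *\<^sub>R y - x))
            = b - K * norm (t *\<^sub>R (inverse t *\<^sub>R y - x))"
          using t by (simp add: algebra_simps del: scaleR_right_diff_distrib)
        finally show ?thesis using t by (simp add: algebra_simps)
      qed
    qed
    moreover have "G \<subseteq> H"
    proof
      fix p assume "p \<in> G"
      then have "p = (fst p + 0 *\<^sub>R x, snd p + 0 * a)" "(fst p, snd p) \<in> G" by auto
      then show "p \<in> H" unfolding H_def by blast
    qed
    ultimately have "H \<in> A"
      using G by (auto simp: A_def H_def)
    then have "H = G" using max \<open>G \<subseteq> H\<close> by blast
    moreover have "(x, a) \<in> H"
      using zero by (force simp: H_def)
    ultimately show ?thesis by blast
  qed
  define \<psi> where "\<psi> x = (THE a. (x, a) \<in> G)" for x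
  have \<psi>: "(x, a) \<in> G \<longleftrightarrow> \<psi> x = a" for x a
  proof -
    have "\<exists>!a. (x, a) \<in> G" using total sv by blast
    from theI'[OF this] sv show ?thesis unfolding \<psi>_def by blast
  qed
  show ?thesis
  proof
    show "bounded_linear \<psi>"
    proof (rule bounded_linear_intro)
      show "\<psi> (x + y) = \<psi> x + \<psi> y" for x y using add \<psi> by blast
      show "\<psi> (r *\<^sub>R x) = r *\<^sub>R \<psi> x" for r x using scale \<psi> by fastforce
      show "norm (\<psi> x) \<le> norm x * K" for x
        using domG[of x "\<psi> x"] domG[OF scale[of x "\<psi> x" "-1"]] \<psi>[of x "\<psi> x"]
        by (auto simp: abs_le_iff mult.commute)
    qed
    show "\<psi> x = a" if "(x, a) \<in> G0" for x a using that G(2) \<psi> by blast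
  qed
qed

text \<open>The real functional is found on \<open>L \<oplus> \<real>v\<close>, where the coefficient of \<open>v\<close> is dominated by
  the norm because a ball about \<open>v\<close> misses \<open>L\<close>. A real functional \<open>\<psi>\<close> becomes the complex
  functional \<open>\<psi> x - \<i> \<psi> (\<i> x)\<close>.\<close>

lemma separating_functional:
  fixes L :: "'a::complex_banach set"
  assumes L: "closed_csubspace L" and v: "v \<notin> L"
  obtains \<phi> :: "'a \<Rightarrow> complex" where "bounded_linear \<phi>" "\<And>c x. \<phi> (c *\<^sub>C x) = c * \<phi> x"
    "\<And>x. x \<in> L \<Longrightarrow> \<phi> x = 0" "\<phi> v = 1"
proof -
  have Lc: "complex_vector.subspace L" and L': "subspace L" and cl: "closed L"
    using L csubspace_imp_subspace by (auto simp: closed_csubspace_def)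
  obtain d where "d > 0" "ball v d \<subseteq> - L"
    using cl v by (meson ComplI open_Compl openE)
  then have d: "d > 0" "\<And>y. y \<in> L \<Longrightarrow> d \<le> dist v y"
    by (auto simp: subset_iff not_less[symmetric])
  define G0 where "G0 = {(l + t *\<^sub>R v, t) | l t. l \<in> L}"
  have "subspace G0"
  proof (rule subspaceI)
    show "0 \<in> G0"
      using subspace_0[OF L'] unfolding G0_def zero_prod_def by force
    show "p + q \<in> G0" if pq: "p \<in> G0" "q \<in> G0" for p q
    proof -
      obtain l t l' t' where pq': "p = (l + t *\<^sub>R v, t)" "q = (l' + t' *\<^sub>R v, t')" "l \<in> L" "l' \<in> L"
        using pq by (auto simp: G0_def)
      have "p + q = ((l + l') + (t + t') *\<^sub>R v, t + t')" by (simp add: pq' algebra_simps)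
      then show ?thesis using subspace_add[OF L' pq'(3,4)] unfolding G0_def by blast
    qed
    show "c *\<^sub>R p \<in> G0" if pp: "p \<in> G0" for c p
    proof -
      obtain l t where p: "p = (l + t *\<^sub>R v, t)" "l \<in> L"
        using pp by (auto simp: G0_def)
      have "c *\<^sub>R p = (c *\<^sub>R l + (c * t) *\<^sub>R v, c * t)" by (simp add: p algebra_simps)
      then show ?thesis using subspace_scale[OF L' p(2)] unfolding G0_def by blast
    qed
  qed
  moreover have "a \<le> inverse d * norm x" if xa: "(x, a) \<in> G0" for x a
  proof (cases "a = 0")
    case True then show ?thesis using d by simp
  next
    case False
    obtain l where l: "x = l + a *\<^sub>R v" "l \<in> L" using xa by (auto simp: G0_def)
    have "d \<le> dist v (- inverse a *\<^sub>R l)"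
      using d(2) subspace_scale[OF L' l(2)] by blast
    then have "\<bar>a\<bar> * d \<le> norm (a *\<^sub>R (v + inverse a *\<^sub>R l))"
      unfolding norm_scaleR by (intro mult_left_mono) (auto simp: dist_norm)
    then have "\<bar>a\<bar> * d \<le> norm x" using False l by (simp add: scaleR_add_right add.commute)
    moreover have "a * d \<le> \<bar>a\<bar> * d" using d(1) by (intro mult_right_mono) auto
    ultimately have "a * d \<le> norm x" by linarith
    then show ?thesis using d(1) by (simp add: field_simps)
  qed
  ultimately obtain \<psi> :: "'a \<Rightarrow> real" where bl: "bounded_linear \<psi>" and \<psi>: "\<And>x a. (x, a) \<in> G0 \<Longrightarrow> \<psi> x = a"
    using dominated_functional_extension[of G0 "inverse d"] d(1) by auto
  interpret \<psi>: bounded_linear \<psi> by (fact bl)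
  have \<psi>L: "\<psi> l = 0" if "l \<in> L" for l
    using that by (intro \<psi>) (force simp: G0_def)
  have \<psi>v: "\<psi> v = 1"
    using subspace_0[OF L'] by (intro \<psi>) (force simp: G0_def)
  define \<phi> where "\<phi> x = complex_of_real (\<psi> x) - \<i> * complex_of_real (\<psi> (\<i> *\<^sub>C x))" for x
  have \<phi>: "bounded_linear \<phi>"
    unfolding \<phi>_def
    by (intro bounded_linear_sub bounded_linear_const_mult bounded_linear_compose[OF bounded_linear_of_real]
        bl bounded_linear_compose[OF bl] bounded_linear_scaleC_right)
  interpret \<phi>: bounded_linear \<phi> by (fact \<phi>)
  have \<phi>r: "\<phi> (of_real r *\<^sub>C x) = of_real r * \<phi> x" for r x
    using \<phi>.scaleR[of r x] by (simp add: scaleC_of_real scaleR_conv_of_real)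
  have m1: "(-1) *\<^sub>C x = - x" for x :: 'a
    using scaleC_of_real[of "-1" x] by simp
  have \<phi>i: "\<phi> (\<i> *\<^sub>C x) = \<i> * \<phi> x" for x
    by (simp add: \<phi>_def scaleC_scaleC m1 \<psi>.neg algebra_simps)
  have \<phi>c: "\<phi> (c *\<^sub>C x) = c * \<phi> x" for c x
  proof -
    have "\<phi> (c *\<^sub>C x) = \<phi> (of_real (Re c) *\<^sub>C x + \<i> *\<^sub>C (of_real (Im c) *\<^sub>C x))"
      unfolding scaleC_scaleC scaleC_add_left[symmetric] complex_eq[symmetric] by simp
    also have "\<dots> = (of_real (Re c) + \<i> * of_real (Im c)) * \<phi> x"
      unfolding \<phi>.add \<phi>r \<phi>i by (simp add: algebra_simps)
    finally show ?thesis by (simp flip: complex_eq)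
  qed
  have v0: "\<phi> v \<noteq> 0"
    by (simp add: \<phi>_def \<psi>v complex_eq_iff)
  show ?thesis
  proof
    show "bounded_linear (\<lambda>x. inverse (\<phi> v) * \<phi> x)"
      by (intro bounded_linear_const_mult \<phi>)
    show "inverse (\<phi> v) * \<phi> x = 0" if "x \<in> L" for x
      using that complex_vector.subspace_scale[OF Lc that, of \<i>] by (simp add: \<phi>_def \<psi>L)
  qed (use v0 in \<open>simp_all add: \<phi>c\<close>)
qed

section \<open>Surjections between Banach spaces\<close>

text \<open>By Baire's theorem the closure of the image of some ball has interior in the range, which by
  linearity gives approximate preimages of controlled norm with half of the norm as error.\<close>

lemma approximate_preimages:
  fixes T :: "'a::real_normed_vector \<Rightarrow> 'b::banach"
  assumes T: "bounded_linear T" and M: "subspace M" and cl: "closed (T ` M)"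
  obtains C where "C > 0" "\<And>y. y \<in> T ` M \<Longrightarrow> \<exists>x\<in>M. norm x \<le> C * norm y \<and> norm (y - T x) \<le> norm y / 2"
proof -
  interpret T: bounded_linear T by (fact T)
  define Y where "Y = T ` M"
  have Y: "subspace Y" unfolding Y_def using M T.linear_axioms by (intro linear_subspace_image)
  define A where "A k = closure (T ` (M \<inter> cball 0 (real k)))" for k :: nat
  have AY: "A k \<subseteq> Y" for k
    unfolding A_def using cl by (intro closure_minimal) (auto simp: Y_def)
  have "Y \<subseteq> (\<Union>k. A k)"
  proof
    fix y assume "y \<in> Y"
    then obtain x where x: "x \<in> M" "y = T x" by (auto simp: Y_def)
    obtain k :: nat where "norm x \<le> real k" using real_arch_simple by blast
    with x have "y \<in> A k" unfolding A_def by (intro subsetD[OF closure_subset]) auto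
    then show "y \<in> (\<Union>k. A k)" by blast
  qed
  then have un: "(\<Union>k. A k) = Y" using AY by blast
  have "\<exists>k. (top_of_set Y) interior_of (A k) \<noteq> {}"
  proof (rule ccontr)
    assume "\<not> ?thesis"
    then have "(top_of_set Y) interior_of (\<Union>(range A)) = {}"
      using cl AY
      by (intro Baire_category_alt disjI1 completely_metrizable_space_closedin[OF completely_metrizable_space_euclidean])
         (auto simp: Y_def A_def closed_subset)
    moreover have "(top_of_set Y) interior_of Y = Y"
      using interior_of_topspace[of "top_of_set Y"] by simp
    ultimately show False using un subspace_0[OF Y] by simp
  qed
  then obtain k y0 where "y0 \<in> (top_of_set Y) interior_of (A k)" by blast
  then obtain U where "openin (top_of_set Y) U" "y0 \<in> U" "U \<subseteq> A k"
    by (auto simp: interior_of_def)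
  then obtain r where r: "r > 0" "ball y0 r \<inter> Y \<subseteq> A k" and y0: "y0 \<in> Y" "y0 \<in> A k"
    unfolding openin_contains_ball by blast
  have step: "\<exists>x\<in>M. norm x \<le> 2 * real k \<and> norm (y - T x) < e" if y: "y \<in> Y" "norm y < r" and e: "e > 0" for y e
  proof -
    have "y0 + y \<in> A k"
      using r y y0 Y by (auto simp: subset_iff dist_norm subspace_add)
    with e have "\<exists>z\<in>T ` (M \<inter> cball 0 (real k)). dist z (y0 + y) < e / 2"
      by (auto simp: A_def closure_approachable elim!: allE[of _ "e/2"])
    then obtain a where a: "a \<in> M" "norm a \<le> k" "dist (T a) (y0 + y) < e/2" by auto
    from e y0(2) have "\<exists>z\<in>T ` (M \<inter> cball 0 (real k)). dist z y0 < e / 2"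
      by (auto simp: A_def closure_approachable elim!: allE[of _ "e/2"])
    then obtain b where b: "b \<in> M" "norm b \<le> k" "dist (T b) y0 < e/2" by auto
    have "y - T (a - b) = (T b - y0) - (T a - (y0 + y))" by (simp add: T.diff)
    then have "norm (y - T (a - b)) \<le> norm (T b - y0) + norm (T a - (y0 + y))"
      by (metis norm_triangle_ineq4)
    moreover have "norm (a - b) \<le> 2 * real k"
      using norm_triangle_ineq4[of a b] a(2) b(2) by linarith
    ultimately show ?thesis
      using a b M by (intro bexI[of _ "a - b"]) (auto simp: dist_norm subspace_diff)
  qed
  show ?thesis
  proof
    show "4 * real k / r + 1 > 0" using r by (simp add: add_nonneg_pos)
  next
    fix y assume y: "y \<in> T ` M"
    show "\<exists>x\<in>M. norm x \<le> (4 * real k / r + 1) * norm y \<and> norm (y - T x) \<le> norm y / 2"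
    proof (cases "y = 0")
      case True
      then show ?thesis using M by (intro bexI[of _ 0]) (auto simp: subspace_0)
    next
      case False
      define s where "s = r / (2 * norm y)"
      have s: "s > 0" using r False by (simp add: s_def)
      have "s *\<^sub>R y \<in> Y" "norm (s *\<^sub>R y) < r"
        using y Y r False by (auto simp: Y_def s_def subspace_scale)
      from step[OF this, of "r / 4"] r obtain x where
        x: "x \<in> M" "norm x \<le> 2 * real k" "norm (s *\<^sub>R y - T x) < r / 4" by auto
      have "norm (y - T (inverse s *\<^sub>R x)) = inverse s * norm (s *\<^sub>R y - T x)"
      proof -
        have "y - T (inverse s *\<^sub>R x) = inverse s *\<^sub>R (s *\<^sub>R y - T x)"
          using s by (simp add: T.scaleR algebra_simps)
        then show ?thesis using s by simp
      qed
      also have "\<dots> \<le> inverse s * (r / 4)" using x s by (intro mult_left_mono) auto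
      also have "\<dots> = norm y / 2" using r False by (simp add: s_def field_simps)
      finally have "norm (y - T (inverse s *\<^sub>R x)) \<le> norm y / 2" .
      moreover have "norm (inverse s *\<^sub>R x) \<le> (4 * real k / r + 1) * norm y"
      proof -
        have "norm (inverse s *\<^sub>R x) \<le> inverse s * (2 * real k)"
          using x s by (simp add: mult_left_mono)
        also have "\<dots> = 4 * real k / r * norm y" using r False by (simp add: s_def field_simps)
        also have "\<dots> \<le> (4 * real k / r + 1) * norm y" by (intro mult_right_mono) auto
        finally show ?thesis .
      qed
      ultimately show ?thesis using x M by (intro bexI[of _ "inverse s *\<^sub>R x"]) (auto simp: subspace_scale)
    qed
  qed
qed

text \<open>The open mapping theorem: correcting the error of an approximate preimage again and again
  gives a geometric series whose sum is a preimage.\<close>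

lemma bounded_preimages:
  fixes T :: "'a::banach \<Rightarrow> 'b::banach"
  assumes T: "bounded_linear T" and M: "subspace M" "closed M" and cl: "closed (T ` M)"
  obtains C where "C > 0" "\<And>y. y \<in> T ` M \<Longrightarrow> \<exists>x\<in>M. T x = y \<and> norm x \<le> C * norm y"
proof -
  interpret T: bounded_linear T by (fact T)
  have Y: "subspace (T ` M)" using M T.linear_axioms by (intro linear_subspace_image)
  obtain C where C: "C > 0" and ap: "\<And>y. y \<in> T ` M \<Longrightarrow> \<exists>x\<in>M. norm x \<le> C * norm y \<and> norm (y - T x) \<le> norm y / 2"
    using approximate_preimages[OF T M(1) cl] by blast
  obtain g where g: "\<And>y. y \<in> T ` M \<Longrightarrow> g y \<in> M \<and> norm (g y) \<le> C * norm y \<and> norm (y - T (g y)) \<le> norm y / 2"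
    using ap by metis
  show ?thesis
  proof
    show "2 * C > 0" using C by simp
  next
    fix y assume y: "y \<in> T ` M"
    define res where "res n = ((\<lambda>y. y - T (g y)) ^^ n) y" for n
    have resY: "res n \<in> T ` M" for n
      by (induction n) (use y g Y in \<open>auto simp: res_def intro!: subspace_diff\<close>)
    have res_le: "norm (res n) \<le> norm y * (1/2) ^ n" for n
    proof (induction n)
      case (Suc n)
      have "norm (res (Suc n)) \<le> norm (res n) / 2" using g[OF resY[of n]] by (simp add: res_def)
      with Suc show ?case by simp
    qed (simp add: res_def)
    define x where "x n = g (res n)" for n
    have xM: "x n \<in> M" for n using g[OF resY] by (simp add: x_def)
    have x_le: "norm (x n) \<le> C * norm y * (1/2) ^ n" for n
      using g[OF resY[of n]] mult_left_mono[OF res_le[of n], of C] C unfolding x_def mult.assoc by linarith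
    have sum_geo: "(\<lambda>n. C * norm y * (1/2) ^ n) sums (C * norm y * 2)"
      using geometric_sums[of "1/2::real"] by (intro sums_mult) simp
    have sx: "summable (\<lambda>n. norm (x n))"
      by (rule summable_comparison_test'[OF sums_summable[OF sum_geo]]) (simp add: x_le)
    then have xs: "x sums suminf x"
      by (simp add: summable_norm_cancel summable_sums)
    have "(\<Sum>i<n. T (x i)) = y - res n" for n
      by (induction n) (simp_all add: x_def res_def)
    moreover have "res \<longlonglongrightarrow> 0"
    proof (rule Lim_null_comparison[OF _ tendsto_mult_right_zero])
      show "\<forall>\<^sub>F n in sequentially. norm (res n) \<le> norm y * (1/2) ^ n" using res_le by simp
    qed (rule LIMSEQ_power_zero, simp)
    ultimately have "(\<lambda>n. T (x n)) sums y"
      unfolding sums_def using tendsto_diff[OF tendsto_const[of y]] by fastforce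
    with T.sums[OF xs] have "T (suminf x) = y" using sums_unique2 by blast
    moreover have "suminf x \<in> M"
    proof (rule Lim_in_closed_set[OF M(2) _ _ xs[unfolded sums_def]])
      show "\<forall>\<^sub>F n in sequentially. (\<Sum>i<n. x i) \<in> M" using subspace_sum[OF M(1), of "{..<_}" x] xM by simp
    qed simp
    moreover have "norm (suminf x) \<le> 2 * C * norm y"
      using summable_norm[OF sx] suminf_le[OF x_le sx sums_summable[OF sum_geo]] sums_unique[OF sum_geo]
      by simp
    ultimately show "\<exists>x\<in>M. T x = y \<and> norm x \<le> 2 * C * norm y" by blast
  qed
qed

section \<open>Closed and finite-dimensional subspaces\<close>

lemma closed_csubspace_span_Un_finite:
  fixes L :: "'a::complex_banach set"
  assumes L: "closed_csubspace L" and "finite B"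
  shows "closed_csubspace (complex_vector.span (L \<union> B))"
  using \<open>finite B\<close>
proof (induction B)
  case empty
  then show ?case
    using L by (simp add: closed_csubspace_def complex_vector.span_eq_iff[THEN iffD2])
next
  case (insert b B)
  define S where "S = complex_vector.span (L \<union> B)"
  have S: "closed_csubspace S" using insert by (simp add: S_def)
  then have Ss: "complex_vector.subspace S" by (simp add: closed_csubspace_def)
  show ?case
  proof (cases "b \<in> S")
    case True
    then show ?thesis
      using S by (simp add: S_def complex_vector.span_redundant)
  next
    case False
    obtain \<phi> where \<phi>: "bounded_linear \<phi>" "\<And>c x. \<phi> (c *\<^sub>C x) = c * \<phi> x"
      "\<And>x. x \<in> S \<Longrightarrow> \<phi> x = 0" "\<phi> b = 1"
      using separating_functional[OF S False] by metis
    interpret \<phi>: bounded_linear \<phi> by (fact \<phi>(1))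
    \<comment> \<open>The coefficient of \<open>b\<close> is \<open>\<phi>\<close>, so membership is a closed condition.\<close>
    have "complex_vector.span (L \<union> insert b B) = (\<lambda>x. x - \<phi> x *\<^sub>C b) -` S"
    proof -
      have "(\<exists>k. x - k *\<^sub>C b \<in> S) \<longleftrightarrow> x - \<phi> x *\<^sub>C b \<in> S" for x
      proof
        assume "\<exists>k. x - k *\<^sub>C b \<in> S"
        then obtain k where k: "x - k *\<^sub>C b \<in> S" by blast
        with \<phi>(3)[OF k] have "\<phi> x = k" by (simp add: \<phi>.diff \<phi>(2,4))
        with k show "x - \<phi> x *\<^sub>C b \<in> S" by simp
      qed blast
      then show ?thesis
        by (auto simp: complex_vector.span_insert S_def)
    qed
    moreover have "closed ((\<lambda>x. x - \<phi> x *\<^sub>C b) -` S)"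
    proof (rule continuous_closed_vimage)
      show "closed S" using S by (simp add: closed_csubspace_def)
      from bounded_linear_compose[OF bounded_linear_scaleC_left \<phi>(1)]
      have "bounded_linear (\<lambda>x. x - \<phi> x *\<^sub>C b)"
        by (intro bounded_linear_sub bounded_linear_ident)
      then show "continuous (at x) (\<lambda>x. x - \<phi> x *\<^sub>C b)" for x
        by (rule linear_continuous_at)
    qed
    ultimately have "closed (complex_vector.span (L \<union> insert b B))" by simp
    then show ?thesis by (simp add: closed_csubspace_def del: Un_insert_right)
  qed
qed

lemma finite_basis_of_subset_span:
  fixes V :: "'a::complex_banach set"
  assumes "finite B" "V \<subseteq> complex_vector.span B"
  obtains B' where "finite B'" "B' \<subseteq> V" "V \<subseteq> complex_vector.span B'"
  by (metis assms complex_vector.independent_span_bound complex_vector.maximal_independent_subset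
      subset_trans)

lemma dim_psubset:
  fixes V W :: "'a::complex_banach set"
  assumes V: "complex_vector.subspace V" "V \<subset> W" and W: "finite B" "W \<subseteq> complex_vector.span B"
  shows "complex_vector.dim V < complex_vector.dim W"
proof -
  obtain A where A: "A \<subseteq> V" "complex_vector.independent A" "V \<subseteq> complex_vector.span A"
    "card A = complex_vector.dim V"
    using complex_vector.basis_exists by blast
  obtain A' where A': "A \<subseteq> A'" "A' \<subseteq> W" "complex_vector.independent A'" "W \<subseteq> complex_vector.span A'"
    using complex_vector.maximal_independent_subset_extend[of A W] A V by blast
  have "finite A'"
    using complex_vector.independent_span_bound[OF W(1) A'(3)] A' W by blast
  moreover have "A \<noteq> A'"
    using complex_vector.span_minimal[OF A(1) V(1)] A'(4) V(2) by blast
  ultimately have "card A < card A'" using A'(1) by (simp add: psubset_card_mono psubsetI)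
  moreover have "complex_vector.dim W = card A'"
    using complex_vector.dim_unique[OF A'(2,4,3) refl] .
  ultimately show ?thesis using A by simp
qed

lemma decreasing_subspaces_stabilize:
  fixes V :: "nat \<Rightarrow> 'a::complex_banach set"
  assumes V: "\<And>n. complex_vector.subspace (V n)" "decseq V" and B: "finite B" "V 0 \<subseteq> complex_vector.span B"
  shows "\<exists>n0. \<forall>n\<ge>n0. V n = V n0"
proof -
  obtain n0 where n0: "\<And>n. complex_vector.dim (V n0) \<le> complex_vector.dim (V n)"
    using ex_has_least_nat[of "\<lambda>_. True" 0 "\<lambda>n. complex_vector.dim (V n)"] by auto
  show ?thesis
  proof (intro exI allI impI)
    fix n assume "n \<ge> n0"
    then have "V n \<subseteq> V n0" using V(2) by (simp add: decseqD)
    moreover have "V n0 \<subseteq> complex_vector.span B"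
      using decseqD[OF V(2), of 0 n0] B(2) by simp
    ultimately show "V n = V n0"
      using dim_psubset[OF V(1)[of n] _ B(1), of "V n0"] n0[of n] by (auto simp: not_less)
  qed
qed

section \<open>Operators with closed range and finite-dimensional kernel\<close>

text \<open>If \<open>T (l n) \<rightarrow> T x\<close>, preimages of controlled norm show that \<open>x\<close> is a limit of elements of
  \<open>L + N(T)\<close>, and this subspace is closed because \<open>N(T)\<close> is finite-dimensional.\<close>

lemma closed_csubspace_image:
  fixes T :: "'a::complex_banach \<Rightarrow> 'a"
  assumes T: "bounded_clinear T" and M: "closed_csubspace M" and cl: "closed (T ` M)"
    and B: "finite B" "kernel_on M T \<subseteq> complex_vector.span B"
    and L: "closed_csubspace L" "L \<subseteq> M"
  shows "closed_csubspace (T ` L)"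
proof -
  have Ms: "complex_vector.subspace M" and Mc: "closed M" and Ls: "complex_vector.subspace L"
    using M L by (auto simp: closed_csubspace_def)
  note T_simps = bounded_clinear_simps[OF T]
  obtain B' where B': "finite B'" "B' \<subseteq> kernel_on M T" "kernel_on M T \<subseteq> complex_vector.span B'"
    using finite_basis_of_subset_span[OF B] by blast
  define S where "S = complex_vector.span (L \<union> B')"
  have S: "closed S" "complex_vector.subspace S"
    using closed_csubspace_span_Un_finite[OF L(1) B'(1)] by (auto simp: S_def closed_csubspace_def)
  have LS: "L \<subseteq> S" and KS: "kernel_on M T \<subseteq> S"
    unfolding S_def using complex_vector.span_superset[of "L \<union> B'"] B'(3)
      complex_vector.span_mono[of B' "L \<union> B'"] by auto
  obtain C where C: "\<And>y. y \<in> T ` M \<Longrightarrow> \<exists>x\<in>M. T x = y \<and> norm x \<le> C * norm y"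
    using bounded_preimages[OF bounded_clinear_bounded_linear[OF T] csubspace_imp_subspace[OF Ms] Mc cl]
    by metis
  have "closed (T ` L)"
    unfolding closed_sequential_limits
  proof (intro allI impI, elim conjE)
    fix y y0 assume y: "\<forall>n. y n \<in> T ` L" and lim: "y \<longlonglongrightarrow> y0"
    have "y0 \<in> T ` M"
      using closed_sequentially[OF cl _ lim] y L(2) by blast
    then obtain x where x: "x \<in> M" "y0 = T x" by blast
    have "\<forall>n. \<exists>l. l \<in> L \<and> y n = T l" using y by blast
    then obtain l where l: "\<And>n. l n \<in> L" "\<And>n. y n = T (l n)" by metis
    have "y n - y0 \<in> T ` M" for n
      using l(1)[of n] L(2) x complex_vector.subspace_diff[OF csubspace_image[OF T Ms]] l(2)[of n]
      by blast
    then obtain u where u: "\<And>n. u n \<in> M" "\<And>n. T (u n) = y n - y0" "\<And>n. norm (u n) \<le> C * norm (y n - y0)"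
    proof -
      have "\<forall>n. \<exists>u. u \<in> M \<and> T u = y n - y0 \<and> norm u \<le> C * norm (y n - y0)"
        using C[OF \<open>y _ - y0 \<in> T ` M\<close>] by blast
      then show thesis using that by (auto dest!: choice)
    qed
    have "(\<lambda>n. C * norm (y n - y0)) \<longlonglongrightarrow> 0"
      using lim by (intro tendsto_mult_right_zero tendsto_norm_zero) (rule LIM_zero)
    then have "u \<longlonglongrightarrow> 0"
      by (rule Lim_null_comparison[rotated]) (simp add: u)
    then have "(\<lambda>n. x + u n) \<longlonglongrightarrow> x"
      using tendsto_add[OF tendsto_const[of x], of u 0] by simp
    moreover have "x + u n \<in> S" for n
    proof -
      have "l n - x - u n \<in> kernel_on M T"
        using l[of n] L(2) u[of n] x
        by (auto simp: kernel_on_def T_simps complex_vector.subspace_diff[OF Ms] subset_iff)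
      then have "l n - (l n - x - u n) \<in> S"
        using KS LS l(1)[of n] by (intro complex_vector.subspace_diff[OF S(2), of "l n" "l n - x - u n"]) blast+
      then show ?thesis by (simp add: add.commute)
    qed
    ultimately have "x \<in> S" using closed_sequentially[OF S(1), of "\<lambda>n. x + u n" x] by blast
    then obtain a b where ab: "x = a + b" "a \<in> complex_vector.span L" "b \<in> complex_vector.span B'"
      unfolding S_def complex_vector.span_Un by blast
    have "b \<in> kernel_on M T"
      using ab(3) complex_vector.span_minimal[OF B'(2) csubspace_kernel_on[OF T Ms]] by blast
    moreover have "a \<in> L" using ab(2) Ls complex_vector.span_eq_iff by blast
    ultimately show "y0 \<in> T ` L" using x ab by (auto simp: T_simps kernel_on_def)
  qed
  then show ?thesis using csubspace_image[OF T Ls] by (simp add: closed_csubspace_def)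
qed

lemma funpow_image_Suc: "(T ^^ Suc n) ` M = T ` (T ^^ n) ` M"
  by (simp add: image_comp)

lemma funpow_image_decseq:
  assumes "T ` M \<subseteq> M"
  shows "decseq (\<lambda>n. (T ^^ n) ` M)"
proof (rule decseq_SucI)
  show "(T ^^ Suc n) ` M \<subseteq> (T ^^ n) ` M" for n
    using assms by (auto simp: funpow_swap1)
qed

lemma funpow_image_subset:
  assumes "T ` M \<subseteq> M"
  shows "(T ^^ n) ` M \<subseteq> M"
  using decseqD[OF funpow_image_decseq[OF assms], of 0 n] by simp

lemma closed_csubspace_funpow_image:
  fixes T :: "'a::complex_banach \<Rightarrow> 'a"
  assumes T: "bounded_clinear T" and M: "closed_csubspace M" "T ` M \<subseteq> M" and cl: "closed (T ` M)"
    and B: "finite B" "kernel_on M T \<subseteq> complex_vector.span B"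
  shows "closed_csubspace ((T ^^ n) ` M)"
proof (induction n)
  case (Suc n)
  show ?case
    unfolding funpow_image_Suc
    by (intro closed_csubspace_image[OF T M(1) cl B] Suc funpow_image_subset[OF M(2)])
qed (use M in simp)

text \<open>The preimages of \<open>x\<close> in the successive ranges differ by elements of the finite-dimensional
  spaces \<open>N(T) \<inter> R(T\<^sup>n)\<close>, which stabilize; hence one preimage lies in all the ranges.\<close>

lemma image_hyperrange:
  fixes T :: "'a::complex_banach \<Rightarrow> 'a"
  assumes T: "bounded_clinear T" and M: "closed_csubspace M" "T ` M \<subseteq> M"
    and B: "finite B" "kernel_on M T \<subseteq> complex_vector.span B"
  shows "T ` (\<Inter>n. (T ^^ n) ` M) = (\<Inter>n. (T ^^ n) ` M)"
proof
  note dec = decseqD[OF funpow_image_decseq[OF M(2)]]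
  have "T ` (\<Inter>n. (T ^^ n) ` M) \<subseteq> (T ^^ k) ` M" for k
  proof -
    have "T ` (\<Inter>n. (T ^^ n) ` M) \<subseteq> T ` (T ^^ k) ` M" by blast
    also have "\<dots> \<subseteq> (T ^^ k) ` M" unfolding funpow_image_Suc[symmetric] by (rule dec) simp
    finally show ?thesis .
  qed
  then show "T ` (\<Inter>n. (T ^^ n) ` M) \<subseteq> (\<Inter>n. (T ^^ n) ` M)" by blast
next
  note dec = decseqD[OF funpow_image_decseq[OF M(2)]]
  have Ms: "complex_vector.subspace M" using M by (simp add: closed_csubspace_def)
  have Rs: "complex_vector.subspace ((T ^^ n) ` M)" for n
    by (intro csubspace_image bounded_clinear_funpow T Ms)
  define V where "V n = kernel_on M T \<inter> (T ^^ n) ` M" for n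
  have Vs: "complex_vector.subspace (V n)" for n
    unfolding V_def by (intro complex_vector.subspace_inter csubspace_kernel_on T Ms Rs)
  have decV: "decseq V" unfolding V_def decseq_def using dec by blast
  have V0: "V 0 \<subseteq> complex_vector.span B" using B(2) by (auto simp: V_def)
  obtain n0 where n0: "\<And>n. n \<ge> n0 \<Longrightarrow> V n = V n0"
    using decreasing_subspaces_stabilize[OF Vs decV B(1) V0] by blast
  show "(\<Inter>n. (T ^^ n) ` M) \<subseteq> T ` (\<Inter>n. (T ^^ n) ` M)"
  proof
    fix x assume x: "x \<in> (\<Inter>n. (T ^^ n) ` M)"
    have "\<exists>u. u \<in> (T ^^ n) ` M \<and> T u = x" for n
    proof -
      have "x \<in> (T ^^ Suc n) ` M" using x by blast
      then show ?thesis unfolding funpow_image_Suc by blast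
    qed
    then obtain u where u: "\<And>n. u n \<in> (T ^^ n) ` M" "\<And>n. T (u n) = x" by metis
    have "u n0 \<in> (T ^^ n) ` M" if n: "n \<ge> n0" for n
    proof -
      have "u n - u n0 \<in> (T ^^ n0) ` M"
        using u(1) dec[OF n] by (intro complex_vector.subspace_diff[OF Rs]) auto
      moreover from this have "u n - u n0 \<in> M" using dec[of 0 n0] by auto
      ultimately have "u n - u n0 \<in> V n0"
        by (simp add: V_def kernel_on_def bounded_clinear_simps[OF T] u)
      with n0[OF n] have "u n - u n0 \<in> (T ^^ n) ` M" by (auto simp: V_def)
      from complex_vector.subspace_diff[OF Rs u(1)[of n] this] show ?thesis by simp
    qed
    moreover have "u n0 \<in> (T ^^ n) ` M" if "n \<le> n0" for n
      using dec[OF that] u(1)[of n0] by blast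
    ultimately have "u n0 \<in> (\<Inter>n. (T ^^ n) ` M)" by (meson INT_I nat_le_linear)
    then show "x \<in> T ` (\<Inter>n. (T ^^ n) ` M)" using u(2) by blast
  qed
qed

section \<open>Eigenvectors depending analytically on the eigenvalue\<close>

text \<open>The radius is half of the guaranteed radius of convergence, so that the differentiated series
  converges uniformly on the whole disc.\<close>

lemma analytic_power_series:
  fixes x :: "nat \<Rightarrow> 'a::complex_banach"
  assumes C: "C > 0" and x: "\<And>n. norm (x n) \<le> K * C ^ n"
  obtains f where "analytic_vec_on f (ball 0 (1 / (2 * C)))"
    "\<And>z. z \<in> ball 0 (1 / (2 * C)) \<Longrightarrow> (\<lambda>n. z ^ n *\<^sub>C x n) sums f z"
proof -
  define U where "U = ball (0::complex) (1 / (2 * C))"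
  define d where "d i z = (of_nat i * z ^ (i - 1)) *\<^sub>C x i" for i and z :: complex
  define D where "D z = (\<Sum>i. d i z)" for z
  have K: "K \<ge> 0" using order_trans[OF norm_ge_zero x[of 0]] by simp
  have m: "norm (d i z) \<le> K * C * (of_nat i * (1/2) ^ (i - 1))" if "z \<in> U" for i z
  proof (cases i)
    case (Suc j)
    have "cmod z * C \<le> 1/2" using that C by (simp add: U_def field_simps)
    then have "(cmod z * C) ^ j \<le> (1/2) ^ j" using C by (intro power_mono) auto
    then have "K * C * real i * (cmod z * C) ^ j \<le> K * C * real i * (1/2) ^ j"
      using K C by (intro mult_left_mono) auto
    moreover have "norm (d i z) \<le> real i * cmod z ^ j * (K * C ^ i)"
      unfolding d_def norm_scaleC norm_mult norm_power using Suc x[of i] 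
      by (simp add: mult_left_mono del: of_nat_Suc)
    ultimately show ?thesis using Suc by (simp add: power_mult_distrib algebra_simps del: of_nat_Suc)
  qed (simp add: d_def)
  have "summable (\<lambda>i. real (Suc i) * (1/2) ^ i)"
    using geometric_deriv_sums[of "1/2::real"] by (auto simp: sums_iff)
  then have "summable (\<lambda>i. real i * (1/2) ^ (i - 1))"
    using summable_Suc_iff[of "\<lambda>i. real i * (1/2) ^ (i - 1)"] by simp
  then have "summable (\<lambda>i. K * C * (real i * (1/2) ^ (i - 1)))" by (intro summable_mult)
  from Weierstrass_m_test[OF m this]
  have ul: "uniform_limit U (\<lambda>n z. \<Sum>i<n. d i z) D sequentially" by (simp add: D_def[abs_def])
  have "\<exists>g. \<forall>z\<in>U. (\<lambda>n. z ^ n *\<^sub>C x n) sums g z \<and> (g has_derivative (\<lambda>h. h *\<^sub>C D z)) (at z within U)"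
  proof (rule has_derivative_series)
    show "convex U" by (simp add: U_def)
    show "0 \<in> U" using C by (simp add: U_def)
    show "(\<lambda>n. 0 ^ n *\<^sub>C x n) sums x 0"
      using sums_finite[of "{0}" "\<lambda>n. 0 ^ n *\<^sub>C x n"] by simp
    show "((\<lambda>z. z ^ n *\<^sub>C x n) has_derivative (\<lambda>h. h *\<^sub>C d n z)) (at z within U)" for n z
    proof -
      have "((\<lambda>z. z ^ n) has_derivative (\<lambda>h. h * (of_nat n * z ^ (n - 1)))) (at z within U)"
        using has_field_derivative_imp_has_derivative[OF DERIV_power[OF DERIV_ident[of "at z within U"], of n]]
        by (simp add: mult.commute[of _ "of_nat n * _"])
      from bounded_linear.has_derivative[OF bounded_linear_scaleC_left[of "x n"] this]
      show ?thesis by (simp add: d_def scaleC_scaleC)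
    qed
    show "\<forall>\<^sub>F n in sequentially. \<forall>z\<in>U. \<forall>h. norm ((\<Sum>i<n. h *\<^sub>C d i z) - h *\<^sub>C D z) \<le> e * norm h"
      if e: "e > 0" for e
    proof -
      have "\<forall>\<^sub>F n in sequentially. \<forall>z\<in>U. dist (\<Sum>i<n. d i z) (D z) < e"
        using ul e by (simp add: uniform_limit_iff)
      then show ?thesis
      proof (eventually_elim, intro ballI allI)
        fix n z h assume *: "\<forall>z\<in>U. dist (\<Sum>i<n. d i z) (D z) < e" and z: "z \<in> U"
        have "(\<Sum>i<n. h *\<^sub>C d i z) - h *\<^sub>C D z = h *\<^sub>C ((\<Sum>i<n. d i z) - D z)"
          by (simp add: complex_vector.scale_sum_right complex_vector.scale_right_diff_distrib)
        then show "norm ((\<Sum>i<n. h *\<^sub>C d i z) - h *\<^sub>C D z) \<le> e * norm h"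
          using mult_left_mono[OF less_imp_le[OF bspec[OF * z]], of "cmod h"]
          by (simp add: norm_scaleC dist_norm mult.commute)
      qed
    qed
  qed
  then obtain g where g: "\<And>z. z \<in> U \<Longrightarrow> (\<lambda>n. z ^ n *\<^sub>C x n) sums g z"
    "\<And>z. z \<in> U \<Longrightarrow> (g has_derivative (\<lambda>h. h *\<^sub>C D z)) (at z within U)" by blast
  have "analytic_vec_on g U"
    unfolding analytic_vec_on_def
  proof
    fix z assume z: "z \<in> U"
    have "at z within U = at z" using z by (intro at_within_open) (auto simp: U_def)
    with g(2)[OF z] show "\<exists>D. (g has_derivative (\<lambda>h. h *\<^sub>C D)) (at z)" by auto
  qed
  with g(1) show ?thesis using that unfolding U_def by blast
qed

text \<open>If \<open>T R = R\<close>, then \<open>e\<close> has a backward orbit \<open>x\<^sub>0 = e\<close>, \<open>T x\<^bsub>n+1\<^esub> = x\<^sub>n\<close> in \<open>R\<close> of at most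
  geometric growth, and \<open>f z = \<Sum>n. z\<^sup>n x\<^sub>n\<close> solves \<open>T (f z) = z f z\<close> near \<open>0\<close> with \<open>f 0 = e\<close>.\<close>

lemma SVEP_injective_if_surjective:
  fixes T :: "'a::complex_banach \<Rightarrow> 'a"
  assumes T: "bounded_clinear T" and SVEP: "SVEP_at T 0"
    and R: "closed_csubspace R" "T ` R = R" and e: "e \<in> R" "T e = 0"
  shows "e = 0"
proof -
  interpret T: bounded_linear T using T by (rule bounded_clinear_bounded_linear)
  obtain C where C: "C > 0" "\<And>y. y \<in> R \<Longrightarrow> \<exists>x\<in>R. T x = y \<and> norm x \<le> C * norm y"
  proof -
    have "subspace R" "closed R" "closed (T ` R)"
      using R csubspace_imp_subspace by (auto simp: closed_csubspace_def)
    from bounded_preimages[OF T.bounded_linear_axioms this] that show thesis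
      unfolding R(2) by blast
  qed
  then obtain g where g: "\<And>y. y \<in> R \<Longrightarrow> g y \<in> R \<and> T (g y) = y \<and> norm (g y) \<le> C * norm y" by metis
  define x where "x n = (g ^^ n) e" for n
  have xR: "x n \<in> R" for n by (induction n) (use e g in \<open>auto simp: x_def\<close>)
  have Tx: "T (x (Suc n)) = x n" for n using g[OF xR[of n]] by (simp add: x_def)
  have "norm (x n) \<le> norm e * C ^ n" for n
  proof (induction n)
    case (Suc n)
    have "norm (x (Suc n)) \<le> C * norm (x n)" using g[OF xR[of n]] by (simp add: x_def)
    also have "\<dots> \<le> C * (norm e * C ^ n)" using Suc C by (intro mult_left_mono) auto
    finally show ?case by (simp add: algebra_simps)
  qed (simp add: x_def)
  then obtain f where f: "analytic_vec_on f (ball 0 (1 / (2 * C)))"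
    and fs: "\<And>z. z \<in> ball 0 (1 / (2 * C)) \<Longrightarrow> (\<lambda>n. z ^ n *\<^sub>C x n) sums f z"
    using analytic_power_series[OF C(1)] by blast
  have "T (f z) - z *\<^sub>C f z = 0" if z: "z \<in> ball 0 (1 / (2 * C))" for z
  proof -
    have "(\<lambda>n. z ^ n *\<^sub>C T (x n)) sums T (f z)"
      using T.sums[OF fs[OF z]] by (simp add: bounded_clinear_scaleC[OF T])
    then have "(\<lambda>n. z ^ Suc n *\<^sub>C T (x (Suc n))) sums T (f z)"
      using sums_Suc_iff[of "\<lambda>n. z ^ n *\<^sub>C T (x n)" "T (f z)"] e by (simp add: x_def)
    then have "(\<lambda>n. z *\<^sub>C (z ^ n *\<^sub>C x n)) sums T (f z)"
      by (simp add: Tx scaleC_scaleC)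
    moreover have "(\<lambda>n. z *\<^sub>C (z ^ n *\<^sub>C x n)) sums (z *\<^sub>C f z)"
      by (rule bounded_linear.sums[OF bounded_linear_scaleC_right fs[OF z]])
    ultimately show ?thesis using sums_unique2 by force
  qed
  with SVEP f C(1) have "f 0 = 0"
    unfolding SVEP_at_def by (metis centre_in_ball connected_ball open_ball zero_less_divide_1_iff
        zero_less_mult_iff zero_less_numeral)
  moreover have "(\<lambda>n. 0 ^ n *\<^sub>C x n) sums x 0"
    using sums_finite[of "{0}" "\<lambda>n. 0 ^ n *\<^sub>C x n"] by simp
  ultimately show ?thesis
    using fs[of 0] C(1) sums_unique2[of "\<lambda>n. 0 ^ n *\<^sub>C x n" "f 0" "x 0"] by (simp add: x_def)
qed

section \<open>Splitting off a Jordan chain\<close>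

text \<open>Let \<open>\<phi>\<close> vanish on \<open>T\<^bsup>n+1\<^esup> M\<close> with \<open>\<phi> (T\<^sup>n y) = 1\<close>. The common kernel \<open>M1\<close> in \<open>M\<close> of all
  \<open>\<phi> \<circ> T\<^sup>j\<close> is invariant, and only \<open>j \<le> n\<close> matter. Since \<open>\<phi> (T\<^bsup>i+j\<^esup> y)\<close> is \<open>1\<close> for \<open>i + j = n\<close> and
  \<open>0\<close> for \<open>i + j > n\<close>, these functionals have a triangular matrix against the chain
  \<open>y, T y, \<dots>, T\<^sup>n y\<close>; it is invertible, which makes \<open>M1\<close> a complement of the span of the chain.\<close>

lemma split_off_Jordan_chain:
  fixes T :: "'a::complex_banach \<Rightarrow> 'a"
  assumes T: "bounded_clinear T" and M: "closed_csubspace M" "T ` M \<subseteq> M"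
    and y: "y \<in> M" "(T ^^ Suc n) y = 0"
    and R: "closed_csubspace ((T ^^ Suc n) ` M)" "(T ^^ n) y \<notin> (T ^^ Suc n) ` M"
  obtains M1 B where "closed_csubspace M1" "M1 \<subseteq> M" "T ` M1 \<subseteq> M1" "(T ^^ n) y \<notin> M1"
    "finite B" "B \<subseteq> M" "T ` complex_vector.span B \<subseteq> complex_vector.span B"
    "\<forall>b\<in>complex_vector.span B. (T ^^ Suc n) b = 0"
    "M1 \<inter> complex_vector.span B = {0}"
    "\<forall>x\<in>M. \<exists>m\<in>M1. \<exists>b\<in>complex_vector.span B. x = m + b"
proof -
  have Ms: "complex_vector.subspace M" and Mc: "closed M"
    using M by (auto simp: closed_csubspace_def)
  note Tn = bounded_clinear_funpow[OF T]
  obtain \<phi> where \<phi>: "bounded_linear \<phi>" "\<And>c x. \<phi> (c *\<^sub>C x) = c * \<phi> x"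
    "\<And>x. x \<in> (T ^^ Suc n) ` M \<Longrightarrow> \<phi> x = 0" "\<phi> ((T ^^ n) y) = 1"
    using separating_functional[OF R] by metis
  interpret \<phi>: bounded_linear \<phi> by (fact \<phi>(1))
  have Tadd: "(T ^^ i) ((T ^^ j) x) = (T ^^ (i + j)) x" for i j x
    by (simp add: funpow_add)
  have y0: "(T ^^ i) y = 0" if "i > n" for i
  proof -
    have "(T ^^ i) y = (T ^^ (i - Suc n)) ((T ^^ Suc n) y)"
      unfolding Tadd using that by simp
    then show ?thesis using y(2) by (simp add: bounded_clinear_zero[OF Tn])
  qed
  have \<phi>0: "\<phi> ((T ^^ i) x) = 0" if "x \<in> M" "i > n" for x i
  proof -
    have "(T ^^ i) x = (T ^^ Suc n) ((T ^^ (i - Suc n)) x)"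
      unfolding Tadd using that by simp
    moreover have "(T ^^ (i - Suc n)) x \<in> M"
      using funpow_image_subset[OF M(2)] that by blast
    ultimately show ?thesis by (intro \<phi>(3)) auto
  qed
  define M1 where "M1 = {x \<in> M. \<forall>j. \<phi> ((T ^^ j) x) = 0}"
  define chain where "chain k = (\<lambda>i. (T ^^ i) y) ` {k..n}" for k
  define B where "B = chain 0"
  have span_y: "(T ^^ i) y \<in> complex_vector.span B" for i
  proof (cases "i \<le> n")
    case True
    then show ?thesis by (intro complex_vector.span_base) (simp add: B_def chain_def)
  next
    case False
    then show ?thesis by (simp add: y0 complex_vector.span_zero)
  qed
  have "complex_vector.subspace M1"
    unfolding complex_vector.subspace_def M1_def
    by (auto simp: complex_vector.subspace_0[OF Ms] complex_vector.subspace_add[OF Ms]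
        complex_vector.subspace_scale[OF Ms] bounded_clinear_simps[OF Tn] \<phi>.zero \<phi>.add \<phi>(2))
  moreover have "closed M1"
  proof -
    have "M1 = M \<inter> (\<Inter>j. (\<lambda>x. \<phi> ((T ^^ j) x)) -` {0})" by (auto simp: M1_def)
    moreover have "closed ((\<lambda>x. \<phi> ((T ^^ j) x)) -` {0})" for j
      using bounded_linear_compose[OF \<phi>(1) bounded_clinear_bounded_linear[OF Tn[of j]]]
      by (intro continuous_closed_vimage linear_continuous_at) simp_all
    ultimately show ?thesis using Mc by (auto intro!: closed_Int closed_INT)
  qed
  ultimately have M1: "closed_csubspace M1" by (simp add: closed_csubspace_def)
  have M1T: "T ` M1 \<subseteq> M1"
  proof -
    have "\<phi> ((T ^^ j) (T x)) = 0" if "x \<in> M1" for x j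
      using that funpow_swap1[of T j x] by (auto simp: M1_def dest: spec[of _ "Suc j"])
    then show ?thesis using M(2) by (auto simp: M1_def)
  qed
  have BT: "T ` complex_vector.span B \<subseteq> complex_vector.span B"
  proof -
    have "B \<subseteq> T -` complex_vector.span B"
    proof
      fix b assume "b \<in> B"
      then obtain i where "b = (T ^^ i) y" by (auto simp: B_def chain_def)
      then show "b \<in> T -` complex_vector.span B" using span_y[of "Suc i"] by simp
    qed
    from complex_vector.span_minimal[OF this csubspace_vimage[OF T complex_vector.subspace_span]]
    show ?thesis by blast
  qed
  have kill: "(T ^^ i) b = 0" if b: "b \<in> complex_vector.span (chain k)" and i: "i + k > n" for b i k
  proof -
    have "chain k \<subseteq> (T ^^ i) -` {0}"
      using i y0 by (auto simp: chain_def Tadd)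
    from complex_vector.span_minimal[OF this csubspace_vimage[OF Tn complex_vector.subspace_single_0]]
    show ?thesis using b by blast
  qed
  \<comment> \<open>In an element of \<open>M1\<close> the coefficients along the chain vanish one after another.\<close>
  have peel: "x \<in> complex_vector.span (chain (Suc k))"
    if x: "x \<in> M1" "x \<in> complex_vector.span (chain k)" and k: "k \<le> n" for x k
  proof -
    have "chain k = insert ((T ^^ k) y) (chain (Suc k))"
      using k by (auto simp: chain_def atLeastAtMost_insertL[symmetric])
    then obtain a where a: "x - a *\<^sub>C (T ^^ k) y \<in> complex_vector.span (chain (Suc k))"
      using x(2) complex_vector.span_breakdown_eq[of x "(T ^^ k) y" "chain (Suc k)"] by auto
    have "(T ^^ (n - k)) (x - a *\<^sub>C (T ^^ k) y) = 0"
      using kill[OF a, of "n - k"] k by simp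
    then have "(T ^^ (n - k)) x = a *\<^sub>C (T ^^ n) y"
      using k by (simp add: bounded_clinear_simps[OF Tn] Tadd)
    then have "a = 0"
      using x(1) \<phi>(2,4) by (auto simp: M1_def dest: spec[of _ "n - k"])
    with a show ?thesis by simp
  qed
  have disj: "x = 0" if x: "x \<in> M1" "x \<in> complex_vector.span B" for x
  proof -
    have "k \<le> Suc n \<Longrightarrow> x \<in> complex_vector.span (chain k)" for k
      by (induction k) (use x peel in \<open>auto simp: B_def\<close>)
    from this[of "Suc n"] show ?thesis by (simp add: chain_def)
  qed
  \<comment> \<open>A multiple of \<open>T\<^bsup>n-k\<^esup> y\<close> corrects the value of \<open>\<phi> \<circ> T\<^sup>k\<close> without disturbing
    the functionals with a larger index.\<close>
  have sum: "\<exists>m\<in>M1. \<exists>b\<in>complex_vector.span B. x = m + b"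
    if "k \<le> Suc n" "x \<in> M" "\<And>j. j \<ge> k \<Longrightarrow> \<phi> ((T ^^ j) x) = 0" for k x
    using that
  proof (induction k arbitrary: x)
    case 0
    then have "x \<in> M1" by (simp add: M1_def)
    then show ?case using complex_vector.span_zero by force
  next
    case (Suc k)
    define b where "b = \<phi> ((T ^^ k) x) *\<^sub>C (T ^^ (n - k)) y"
    have bB: "b \<in> complex_vector.span B"
      unfolding b_def by (intro complex_vector.span_scale span_y)
    have "(T ^^ (n - k)) y \<in> M" using funpow_image_subset[OF M(2)] y(1) by blast
    then have "x - b \<in> M"
      unfolding b_def using Suc.prems
      by (intro complex_vector.subspace_diff[OF Ms] complex_vector.subspace_scale[OF Ms])
    moreover have "\<phi> ((T ^^ j) (x - b)) = 0" if j: "j \<ge> k" for j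
    proof (cases "j = k")
      case True
      have "(T ^^ k) b = \<phi> ((T ^^ k) x) *\<^sub>C (T ^^ n) y"
        using Suc.prems(1) by (simp add: b_def bounded_clinear_simps[OF Tn] Tadd)
      then show ?thesis using True by (simp add: bounded_clinear_simps[OF Tn] \<phi>.diff \<phi>(2,4))
    next
      case False
      then have "(T ^^ j) b = 0"
        using j Suc.prems(1) y0[of "j + (n - k)"] by (simp add: b_def bounded_clinear_simps[OF Tn] Tadd)
      then show ?thesis
        using False j Suc.prems(3)[of j] by (simp add: bounded_clinear_simps[OF Tn])
    qed
    ultimately obtain m b' where "m \<in> M1" "b' \<in> complex_vector.span B" "x - b = m + b'"
      using Suc.IH[of "x - b"] Suc.prems(1) by auto
    then show ?case
      using bB by (intro bexI[of _ m] bexI[of _ "b' + b"]) (auto simp: complex_vector.span_add algebra_simps)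
  qed
  show ?thesis
  proof
    show "(T ^^ n) y \<notin> M1"
    proof
      assume "(T ^^ n) y \<in> M1"
      then have "\<phi> ((T ^^ 0) ((T ^^ n) y)) = 0" unfolding M1_def by blast
      with \<phi>(4) show False by simp
    qed
    show "finite B" by (simp add: B_def chain_def)
    show "B \<subseteq> M" using funpow_image_subset[OF M(2)] y(1) by (auto simp: B_def chain_def)
    show "\<forall>b\<in>complex_vector.span B. (T ^^ Suc n) b = 0"
      using kill[of _ 0 "Suc n"] unfolding B_def by (metis add_0_right lessI)
    show "M1 \<inter> complex_vector.span B = {0}"
      using disj complex_vector.span_zero M1 complex_vector.subspace_0
      by (auto simp: closed_csubspace_def)
    show "\<forall>x\<in>M. \<exists>m\<in>M1. \<exists>b\<in>complex_vector.span B. x = m + b"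
      using sum[of "Suc n"] \<phi>0 by auto
  qed (use M1 M1T BT in \<open>auto simp: M1_def\<close>)
qed

section \<open>Quasi-nilpotent parts\<close>

text \<open>The open mapping theorem makes the algebraic inverse bounded.\<close>

lemma invertible_onI:
  fixes A :: "'a::complex_banach \<Rightarrow> 'a"
  assumes A: "bounded_clinear A" and N: "closed_csubspace N" and surj: "A ` N = N"
    and inj: "\<And>x. x \<in> N \<Longrightarrow> A x = 0 \<Longrightarrow> x = 0"
  shows "invertible_on N A"
proof -
  have Ns: "complex_vector.subspace N" and Nc: "closed N" using N by (auto simp: closed_csubspace_def)
  have "inj_on A N"
  proof (rule inj_onI)
    fix x x' assume x: "x \<in> N" "x' \<in> N" "A x = A x'"
    then have "x - x' = 0"
      using inj[of "x - x'"] complex_vector.subspace_diff[OF Ns x(1,2)] by (simp add: bounded_clinear_simps[OF A])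
    then show "x = x'" by simp
  qed
  define S where "S = inv_into N A"
  have SN: "S x \<in> N" and AS: "A (S x) = x" if "x \<in> N" for x
    using that surj by (auto simp: S_def inv_into_into f_inv_into_f)
  have SA: "S (A x) = x" if "x \<in> N" for x
    using that \<open>inj_on A N\<close> by (simp add: S_def)
  have SI: "S y = x" if "x \<in> N" "A x = y" for x y
    using SA[OF that(1)] that(2) by simp
  have "closed (A ` N)" using Nc surj by simp
  then obtain C where C: "\<And>y. y \<in> A ` N \<Longrightarrow> \<exists>x\<in>N. A x = y \<and> norm x \<le> C * norm y"
    using bounded_preimages[OF bounded_clinear_bounded_linear[OF A] csubspace_imp_subspace[OF Ns] Nc]
    by metis
  have "norm (S y) \<le> C * norm y" if "y \<in> N" for y
    using C[of y] SI that surj by auto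
  moreover have "S (x + y) = S x + S y" if "x \<in> N" "y \<in> N" for x y
    using that SN AS by (intro SI) (auto simp: bounded_clinear_simps[OF A] complex_vector.subspace_add[OF Ns])
  moreover have "S (c *\<^sub>C x) = c *\<^sub>C S x" if "x \<in> N" for c x
    using that SN AS by (intro SI) (auto simp: bounded_clinear_simps[OF A] complex_vector.subspace_scale[OF Ns])
  ultimately show ?thesis
    unfolding invertible_on_def using SN AS SA by (intro exI[of _ S]) blast
qed

lemma invertible_onD:
  assumes A: "bounded_clinear A" and N: "complex_vector.subspace N" and inv: "invertible_on N A"
  shows "N \<subseteq> A ` N" "\<And>x. x \<in> N \<Longrightarrow> A x = 0 \<Longrightarrow> x = 0"
proof -
  obtain S where S: "S ` N \<subseteq> N" "\<And>x. x \<in> N \<Longrightarrow> S (A x) = x \<and> A (S x) = x"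
    using inv unfolding invertible_on_def by blast
  show "N \<subseteq> A ` N" using S by force
  show "x = 0" if "x \<in> N" "A x = 0" for x
    using S(2)[OF that(1)] S(2)[OF complex_vector.subspace_0[OF N]] that(2)
    by (simp add: bounded_clinear_zero[OF A])
qed

text \<open>Surjectivity goes by induction on the order of nilpotency of the single vector \<open>x\<close>: a
  preimage of \<open>T x\<close> under \<open>T - z\<close> yields one of \<open>x\<close>, because \<open>z x = T x - (T - z) x\<close>.\<close>

lemma nilpotent_bijective:
  fixes T :: "'a::complex_banach \<Rightarrow> 'a"
  assumes T: "bounded_clinear T" and W: "complex_vector.subspace W" "T ` W \<subseteq> W"
    and nil: "\<forall>x\<in>W. (T ^^ p) x = 0" and z: "z \<noteq> 0"
  shows "\<And>x. x \<in> W \<Longrightarrow> T x - z *\<^sub>C x = 0 \<Longrightarrow> x = 0" "W \<subseteq> (\<lambda>x. T x - z *\<^sub>C x) ` W"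
proof -
  note T_simps = bounded_clinear_simps[OF T]
  show "x = 0" if x: "x \<in> W" "T x - z *\<^sub>C x = 0" for x
  proof -
    have "(T ^^ k) x = z ^ k *\<^sub>C x" for k
      by (induction k) (use x in \<open>simp_all add: T_simps scaleC_scaleC mult.commute\<close>)
    from this[of p] nil x(1) z show ?thesis by simp
  qed
  have "\<exists>w\<in>W. x = T w - z *\<^sub>C w" if "x \<in> W" "(T ^^ k) x = 0" for x k
    using that
  proof (induction k arbitrary: x)
    case 0
    then show ?case
      using complex_vector.subspace_0[OF W(1)] by (intro bexI[of _ 0]) (auto simp: T_simps)
  next
    case (Suc k)
    have "T x \<in> W" using Suc.prems(1) W(2) by blast
    moreover have "(T ^^ k) (T x) = 0" using Suc.prems(2) by (simp add: funpow_swap1)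
    ultimately obtain w where w: "w \<in> W" "T x = T w - z *\<^sub>C w" using Suc.IH by blast
    have "x = T (inverse z *\<^sub>C (w - x)) - z *\<^sub>C (inverse z *\<^sub>C (w - x))"
      using z w(2) by (simp add: T_simps scaleC_scaleC complex_vector.scale_right_diff_distrib)
    then show ?case
      using w(1) Suc.prems(1)
      by (intro bexI[of _ "inverse z *\<^sub>C (w - x)"] complex_vector.subspace_scale[OF W(1)]
          complex_vector.subspace_diff[OF W(1)])
  qed
  with nil show "W \<subseteq> (\<lambda>x. T x - z *\<^sub>C x) ` W" by blast
qed

text \<open>For \<open>z \<noteq> 0\<close> the operator \<open>T - z\<close> is bijective on each of the two summands, hence on
  their direct sum.\<close>

lemma quasi_nilpotent_on_span_Un:
  fixes T :: "'a::complex_banach \<Rightarrow> 'a"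
  assumes T: "bounded_clinear T" and N: "closed_csubspace N" "T ` N \<subseteq> N" "quasi_nilpotent_on N T"
    and B: "finite B" "T ` complex_vector.span B \<subseteq> complex_vector.span B"
    and nil: "\<forall>x\<in>complex_vector.span B. (T ^^ p) x = 0"
    and disj: "N \<inter> complex_vector.span B = {0}"
  shows "quasi_nilpotent_on (complex_vector.span (N \<union> B)) T"
proof -
  let ?W = "complex_vector.span B"
  have Ns: "complex_vector.subspace N" using N by (auto simp: closed_csubspace_def)
  have NW: "complex_vector.span (N \<union> B) = {x + y | x y. x \<in> N \<and> y \<in> ?W}"
    unfolding complex_vector.span_Un complex_vector.span_eq_iff[THEN iffD2, OF Ns] ..
  have "invertible_on (complex_vector.span (N \<union> B)) (\<lambda>x. T x - z *\<^sub>C x)" if z: "z \<noteq> 0" for z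
  proof -
    define A where "A x = T x - z *\<^sub>C x" for x
    have A: "bounded_clinear A" unfolding A_def using bounded_clinear_diff_scaleC[OF T] .
    note A_simps = bounded_clinear_simps[OF A]
    have AN: "A ` N \<subseteq> N" and AW: "A ` ?W \<subseteq> ?W"
      using N(2) B(2) unfolding A_def
      by (auto intro!: complex_vector.subspace_diff[OF Ns] complex_vector.subspace_scale[OF Ns]
          complex_vector.span_diff complex_vector.span_scale)
    have "invertible_on N A"
      using N(3) z by (auto simp: quasi_nilpotent_on_def spectrum_on_def A_def[abs_def])
    note invN = invertible_onD[OF A Ns this]
    note invW = nilpotent_bijective[OF T complex_vector.subspace_span B(2) nil z, folded A_def]
    have "invertible_on (complex_vector.span (N \<union> B)) A"
    proof (rule invertible_onI[OF A closed_csubspace_span_Un_finite[OF N(1) B(1)]])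
      show "A ` complex_vector.span (N \<union> B) = complex_vector.span (N \<union> B)"
      proof
        show "A ` complex_vector.span (N \<union> B) \<subseteq> complex_vector.span (N \<union> B)"
          unfolding NW using AN AW by (force simp: A_simps)
        show "complex_vector.span (N \<union> B) \<subseteq> A ` complex_vector.span (N \<union> B)"
        proof
          fix x assume "x \<in> complex_vector.span (N \<union> B)"
          then obtain u v where "x = u + v" "u \<in> N" "v \<in> ?W" unfolding NW by blast
          moreover from this obtain u' v' where "u' \<in> N" "u = A u'" "v' \<in> ?W" "v = A v'"
            using invN(1) invW(2) by blast
          ultimately have "x = A (u' + v')" "u' + v' \<in> complex_vector.span (N \<union> B)"
            unfolding NW by (auto simp: A_simps)
          then show "x \<in> A ` complex_vector.span (N \<union> B)" by blast
        qed
      qed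
      show "x = 0" if x: "x \<in> complex_vector.span (N \<union> B)" and Ax: "A x = 0" for x
      proof -
        obtain u v where uv: "x = u + v" "u \<in> N" "v \<in> ?W" using x unfolding NW by blast
        have "A u = - A v" using Ax uv by (simp add: A_simps eq_neg_iff_add_eq_0)
        then have "A u \<in> N \<inter> ?W"
          using AN AW uv by (auto intro: complex_vector.span_neg)
        then have "A u = 0" using disj by blast
        moreover from this have "A v = 0" using \<open>A u = - A v\<close> by simp
        ultimately show ?thesis using invN(2)[OF uv(2)] invW(1)[OF uv(3)] uv(1) by simp
      qed
    qed
    then show ?thesis by (simp add: A_def[abs_def])
  qed
  then show ?thesis by (auto simp: quasi_nilpotent_on_def spectrum_on_def)
qed

section \<open>Reducing an upper semi-Fredholm summand to a bounded below one\<close>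

lemma Red_transfer_finite_summand:
  assumes Red: "(M, N) \<in> Red T"
    and M1: "closed_csubspace M1" "M1 \<subseteq> M" "T ` M1 \<subseteq> M1"
    and B: "finite B" "B \<subseteq> M" "T ` complex_vector.span B \<subseteq> complex_vector.span B"
    and T: "bounded_clinear T"
    and disj: "M1 \<inter> complex_vector.span B = {0}"
    and sum: "\<forall>x\<in>M. \<exists>m\<in>M1. \<exists>b\<in>complex_vector.span B. x = m + b"
  shows "(M1, complex_vector.span (N \<union> B)) \<in> Red T" "N \<inter> complex_vector.span B = {0}"
proof -
  let ?W = "complex_vector.span B"
  have M: "complex_vector.subspace M" and N: "complex_vector.subspace N" "closed_csubspace N"
    and TN: "T ` N \<subseteq> N" and MN: "M \<inter> N = {0}" and MN': "\<And>x. \<exists>m\<in>M. \<exists>n\<in>N. x = m + n"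
    using Red by (auto simp: Red_def closed_csubspace_def)
  have NW: "complex_vector.span (N \<union> B) = {x + y | x y. x \<in> N \<and> y \<in> ?W}"
    unfolding complex_vector.span_Un complex_vector.span_eq_iff[THEN iffD2, OF N(1)] ..
  have WM: "?W \<subseteq> M" using complex_vector.span_minimal[OF B(2) M] .
  show "N \<inter> ?W = {0}"
    using WM MN complex_vector.subspace_0[OF N(1)] complex_vector.span_zero by blast
  have "T ` complex_vector.span (N \<union> B) \<subseteq> complex_vector.span (N \<union> B)"
    unfolding NW using TN B(3) by (force simp: bounded_clinear_simps[OF T])
  moreover have "M1 \<inter> complex_vector.span (N \<union> B) = {0}"
  proof -
    have "x = 0" if x: "x \<in> M1" "x \<in> complex_vector.span (N \<union> B)" for x
    proof -
      obtain u v where uv: "x = u + v" "u \<in> N" "v \<in> ?W" using x unfolding NW by blast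
      have "x - v \<in> M" using x(1) M1(2) WM uv(3) by (intro complex_vector.subspace_diff[OF M]) auto
      then have "u = 0" using uv MN by auto
      then show ?thesis using uv x(1) disj by auto
    qed
    then show ?thesis
      using M1(1) complex_vector.subspace_0 complex_vector.span_zero by (auto simp: closed_csubspace_def)
  qed
  moreover have "\<exists>m\<in>M1. \<exists>n\<in>complex_vector.span (N \<union> B). x = m + n" for x
  proof -
    obtain m n where mn: "m \<in> M" "n \<in> N" "x = m + n" using MN' by blast
    obtain m1 b where m1: "m1 \<in> M1" "b \<in> ?W" "m = m1 + b" using sum mn(1) by blast
    have "n + b \<in> complex_vector.span (N \<union> B)" unfolding NW using mn(2) m1(2) by blast
    moreover have "x = m1 + (n + b)" using mn(3) m1(3) by (simp add: add_ac)
    ultimately show ?thesis using m1(1) by blast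
  qed
  ultimately show "(M1, complex_vector.span (N \<union> B)) \<in> Red T"
    using M1 closed_csubspace_span_Un_finite[OF N(2) B(1)] by (simp add: Red_def)
qed

lemma bounded_below_on_if_injective:
  fixes T :: "'a::complex_banach \<Rightarrow> 'a"
  assumes T: "bounded_clinear T" and M: "closed_csubspace M" and cl: "closed (T ` M)"
    and ker: "kernel_on M T \<subseteq> {0}"
  shows "bounded_below_on M T"
proof -
  have Ms: "complex_vector.subspace M" and Mc: "closed M" using M by (auto simp: closed_csubspace_def)
  obtain C where C: "C > 0" "\<And>y. y \<in> T ` M \<Longrightarrow> \<exists>x\<in>M. T x = y \<and> norm x \<le> C * norm y"
    using bounded_preimages[OF bounded_clinear_bounded_linear[OF T] csubspace_imp_subspace[OF Ms] Mc cl]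
    by metis
  have "norm x \<le> C * norm (T x)" if x: "x \<in> M" for x
  proof -
    obtain x' where x': "x' \<in> M" "T x' = T x" "norm x' \<le> C * norm (T x)" using C(2) x by blast
    have "x - x' \<in> kernel_on M T"
      using x x' complex_vector.subspace_diff[OF Ms] by (simp add: kernel_on_def bounded_clinear_simps[OF T])
    then show ?thesis using ker x'(3) by auto
  qed
  then show ?thesis
    unfolding bounded_below_on_def using C(1)
    by (intro exI[of _ "inverse C"]) (simp add: field_simps)
qed

text \<open>Induction on the dimension of the kernel on \<open>M\<close>. By SVEP a nonzero kernel element does not lie
  in every range, so it ends a Jordan chain that can be moved from \<open>M\<close> to the quasi-nilpotent part;
  what remains of \<open>M\<close> no longer contains this element.\<close>

lemma gD_bounded_below_if_SVEP:
  fixes T :: "'a::complex_banach \<Rightarrow> 'a"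
  assumes T: "bounded_clinear T" and SVEP: "SVEP_at T 0" and F: "finite F"
    and "(M, N) \<in> Red T" "kernel_on M T \<subseteq> complex_vector.span F" "closed (T ` M)"
      "quasi_nilpotent_on N T"
  shows "gD_bounded_below T"
  using assms(4-)
proof (induction "complex_vector.dim (kernel_on M T)" arbitrary: M N rule: less_induct)
  case less
  note Red = less.prems(1) and ker = less.prems(2) and cl = less.prems(3) and qn = less.prems(4)
  have M: "closed_csubspace M" "T ` M \<subseteq> M" and Ms: "complex_vector.subspace M"
    and N: "closed_csubspace N" "T ` N \<subseteq> N"
    using Red by (auto simp: Red_def closed_csubspace_def)
  show ?case
  proof (cases "kernel_on M T \<subseteq> {0}")
    case True
    then show ?thesis
      unfolding gD_bounded_below_def using Red qn bounded_below_on_if_injective[OF T M(1) cl True] by auto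
  next
    case False
    then obtain e where e: "e \<in> M" "T e = 0" "e \<noteq> 0" by (auto simp: kernel_on_def)
    note Rn = closed_csubspace_funpow_image[OF T M cl F ker]
    have "closed_csubspace (\<Inter>n. (T ^^ n) ` M)"
      unfolding closed_csubspace_def
    proof
      show "complex_vector.subspace (\<Inter>n. (T ^^ n) ` M)"
        using Rn by (intro complex_vector.subspace_Inter) (auto simp: closed_csubspace_def)
      show "closed (\<Inter>n. (T ^^ n) ` M)"
        using Rn by (intro closed_INT) (auto simp: closed_csubspace_def)
    qed
    from SVEP_injective_if_surjective[OF T SVEP this image_hyperrange[OF T M F ker]] e
    have "\<exists>n. e \<notin> (T ^^ n) ` M" by blast
    \<comment> \<open>The least such exponent, positive as \<open>e \<in> M\<close>, is the number of vectors in the chain that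
      ends in \<open>e\<close>.\<close>
    then obtain k where k: "e \<notin> (T ^^ k) ` M" "\<And>i. i < k \<Longrightarrow> e \<in> (T ^^ i) ` M"
      using exists_least_iff[of "\<lambda>n. e \<notin> (T ^^ n) ` M"] by auto
    obtain n where n: "k = Suc n" using k(1) e(1) by (cases k) auto
    then obtain y where y: "y \<in> M" "e = (T ^^ n) y" using k(2)[of n] by auto
    then have Ty: "(T ^^ Suc n) y = 0" using e(2) by simp
    have yR: "(T ^^ n) y \<notin> (T ^^ Suc n) ` M" using k(1) n y(2) by blast
    obtain M1 B where M1: "closed_csubspace M1" "M1 \<subseteq> M" "T ` M1 \<subseteq> M1" "(T ^^ n) y \<notin> M1"
      and B: "finite B" "B \<subseteq> M" "T ` complex_vector.span B \<subseteq> complex_vector.span B"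
        "\<forall>b\<in>complex_vector.span B. (T ^^ Suc n) b = 0"
      and dec: "M1 \<inter> complex_vector.span B = {0}"
        "\<forall>x\<in>M. \<exists>m\<in>M1. \<exists>b\<in>complex_vector.span B. x = m + b"
      by (rule split_off_Jordan_chain[OF T M y(1) Ty Rn yR])
    note Red' = Red_transfer_finite_summand[OF Red M1(1-3) B(1-3) T dec]
    show ?thesis
    proof (rule less.hyps[OF _ Red'(1)])
      have "kernel_on M1 T \<subset> kernel_on M T"
        using M1(2,4) e y(2) by (auto simp: kernel_on_def)
      then show "complex_vector.dim (kernel_on M1 T) < complex_vector.dim (kernel_on M T)"
        using M1(1) by (intro dim_psubset[OF csubspace_kernel_on[OF T] _ F ker]) (simp add: closed_csubspace_def)
      show "kernel_on M1 T \<subseteq> complex_vector.span F"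
        using M1(2) ker by (auto simp: kernel_on_def)
      show "closed (T ` M1)"
        using closed_csubspace_image[OF T M(1) cl F ker M1(1,2)] by (simp add: closed_csubspace_def)
      show "quasi_nilpotent_on (complex_vector.span (N \<union> B)) T"
        using quasi_nilpotent_on_span_Un[OF T N qn B(1,3,4) Red'(2)] .
    qed
  qed
qed

section \<open>The single valued extension property for generalized Drazin bounded below operators\<close>

text \<open>Functionals reduce the statement to the identity theorem for scalar functions.\<close>

lemma analytic_vec_identity:
  fixes f :: "complex \<Rightarrow> 'a::complex_banach"
  assumes f: "analytic_vec_on f U" and U: "open U" "connected U" "a \<in> U"
    and r: "r > 0" and zero: "\<And>z. z \<in> U \<Longrightarrow> z \<in> ball a r \<Longrightarrow> z \<noteq> a \<Longrightarrow> f z = 0"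
    and w: "w \<in> U"
  shows "f w = 0"
proof (rule ccontr)
  assume "f w \<noteq> 0"
  then have fw: "f w \<notin> {0}" by simp
  have "closed_csubspace {0::'a}" by (simp add: closed_csubspace_def)
  then obtain \<phi> where \<phi>: "bounded_linear \<phi>" "\<And>c x. \<phi> (c *\<^sub>C x) = c * \<phi> x" "\<phi> (f w) = 1"
    using separating_functional[OF _ fw] by metis
  have "(\<lambda>z. \<phi> (f z)) holomorphic_on U"
  proof (rule holomorphic_onI)
    fix z assume "z \<in> U"
    then obtain D where "(f has_derivative (\<lambda>h. h *\<^sub>C D)) (at z)"
      using f by (auto simp: analytic_vec_on_def)
    from bounded_linear.has_derivative[OF \<phi>(1) this]
    have "((\<lambda>z. \<phi> (f z)) has_field_derivative \<phi> D) (at z)"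
      by (simp add: has_field_derivative_def \<phi>(2) mult.commute[of _ "\<phi> D"])
    then show "(\<lambda>z. \<phi> (f z)) field_differentiable (at z within U)"
      by (meson field_differentiable_at_within field_differentiable_def)
  qed
  moreover have "a islimpt (U \<inter> ball a r - {a})"
    using U r by (simp add: islimpt_punctured[symmetric] interior_limit_point interior_open open_Int)
  moreover have "\<phi> (f z) = 0" if "z \<in> U \<inter> ball a r - {a}" for z
    using zero that linear_0[OF bounded_linear.linear[OF \<phi>(1)]] by simp
  ultimately have "\<phi> (f w) = 0"
    using analytic_continuation[of "\<lambda>z. \<phi> (f z)" U "U \<inter> ball a r - {a}" a w] U w by blast
  with \<phi>(3) show False by simp
qed

text \<open>Near \<open>0\<close> the operator \<open>T - z\<close> is injective on \<open>M\<close> by boundedness below and, for \<open>z \<noteq> 0\<close>, on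
  \<open>N\<close> by quasi-nilpotency; so every solution vanishes on a punctured disc.\<close>

lemma SVEP_if_gD_bounded_below:
  fixes T :: "'a::complex_banach \<Rightarrow> 'a"
  assumes T: "bounded_clinear T" and gD: "gD_bounded_below T"
  shows "SVEP_at T 0"
  unfolding SVEP_at_def
proof (intro allI impI ballI, elim conjE)
  fix U f w assume U: "open U" "connected U" "0 \<in> U" and f: "analytic_vec_on f U"
    and eig: "\<forall>z\<in>U. T (f z) - z *\<^sub>C f z = 0" and w: "w \<in> U"
  obtain M N where Red: "(M, N) \<in> Red T" and bb: "bounded_below_on M T" and qn: "quasi_nilpotent_on N T"
    using gD by (auto simp: gD_bounded_below_def)
  obtain c where c: "c > 0" "\<And>x. x \<in> M \<Longrightarrow> c * norm x \<le> norm (T x)"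
    using bb by (auto simp: bounded_below_on_def)
  have Ms: "complex_vector.subspace M" and Ns: "complex_vector.subspace N"
    and inv: "T ` M \<subseteq> M" "T ` N \<subseteq> N" and MN: "M \<inter> N = {0}" and MN': "\<And>x. \<exists>m\<in>M. \<exists>n\<in>N. x = m + n"
    using Red by (auto simp: Red_def closed_csubspace_def)
  have "x = 0" if z: "z \<noteq> 0" "cmod z < c" and x: "T x - z *\<^sub>C x = 0" for x z
  proof -
    define A where "A x = T x - z *\<^sub>C x" for x
    have A: "bounded_clinear A" unfolding A_def using bounded_clinear_diff_scaleC[OF T] .
    obtain m n where mn: "m \<in> M" "n \<in> N" "x = m + n" using MN' by blast
    have AmM: "A m \<in> M" and AnN: "A n \<in> N"
      using mn inv complex_vector.subspace_diff[OF Ms] complex_vector.subspace_scale[OF Ms]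
        complex_vector.subspace_diff[OF Ns] complex_vector.subspace_scale[OF Ns]
      by (auto simp: A_def)
    have "A m + A n = 0" using x mn(3) by (simp add: bounded_clinear_add[OF A, symmetric]) (simp add: A_def)
    then have "A m = - A n" by (simp add: eq_neg_iff_add_eq_0)
    then have "A m \<in> M \<inter> N" using AmM AnN complex_vector.subspace_neg[OF Ns] by simp
    then have Am: "A m = 0" using MN by blast
    then have An: "A n = 0" using \<open>A m = - A n\<close> by simp
    have "invertible_on N A"
      using qn z by (auto simp: quasi_nilpotent_on_def spectrum_on_def A_def[abs_def])
    then have "n = 0" using invertible_onD(2)[OF A Ns] mn(2) An by blast
    moreover have "m = 0"
    proof (rule ccontr)
      assume "m \<noteq> 0"
      have "T m = z *\<^sub>C m" using Am by (simp add: A_def)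
      then have "c * norm m \<le> cmod z * norm m" using c(2)[OF mn(1)] by (simp add: norm_scaleC)
      with \<open>m \<noteq> 0\<close> z(2) show False by simp
    qed
    ultimately show ?thesis using mn(3) by simp
  qed
  with eig have "f z = 0" if "z \<in> U" "z \<in> ball 0 c" "z \<noteq> 0" for z
    using that by auto
  from analytic_vec_identity[OF f U c(1) this w] show "f w = 0" .
qed

section \<open>Comparison of the two spectra\<close>

lemma SVEP_at_shift: "SVEP_at (\<lambda>x. T x - z0 *\<^sub>C x) 0 \<longleftrightarrow> SVEP_at T z0"
proof -
  have shift: "SVEP_at (\<lambda>x. T x - c *\<^sub>C x) (a - c)" if "SVEP_at T a" for T :: "'a \<Rightarrow> 'a" and a c
    unfolding SVEP_at_def
  proof (intro allI impI ballI, elim conjE)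
    fix U f w assume U: "open U" "connected U" "a - c \<in> U" and f: "analytic_vec_on f U"
      and eig: "\<forall>z\<in>U. T (f z) - c *\<^sub>C f z - z *\<^sub>C f z = 0" and w: "w \<in> U"
    let ?V = "(+) c ` U"
    have "open ?V" "connected ?V" "a \<in> ?V"
      using U by (auto intro!: open_translation connected_continuous_image continuous_intros
          image_eqI[of _ _ "a - c"])
    moreover have "analytic_vec_on (\<lambda>z. f (z - c)) ?V"
      unfolding analytic_vec_on_def
    proof
      fix z assume "z \<in> ?V"
      then have "z - c \<in> U" by auto
      then obtain D where "(f has_derivative (\<lambda>h. h *\<^sub>C D)) (at (z - c))"
        using f by (auto simp: analytic_vec_on_def)
      moreover have "((\<lambda>z. z - c) has_derivative (\<lambda>h. h)) (at z)"
        by (auto intro!: derivative_eq_intros)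
      ultimately have "((\<lambda>z. f (z - c)) has_derivative (\<lambda>h. h *\<^sub>C D)) (at z)"
        using has_derivative_compose[of "\<lambda>z. z - c" "\<lambda>h. h" z UNIV f] by blast
      then show "\<exists>D. ((\<lambda>z. f (z - c)) has_derivative (\<lambda>h. h *\<^sub>C D)) (at z)" by blast
    qed
    moreover have "\<forall>z\<in>?V. T (f (z - c)) - z *\<^sub>C f (z - c) = 0"
      using eig by (auto simp: scaleC_add_left algebra_simps)
    ultimately have "\<forall>z\<in>?V. f (z - c) = 0"
      using that unfolding SVEP_at_def by blast
    then show "f w = 0" using w by auto
  qed
  show ?thesis
  proof
    assume "SVEP_at (\<lambda>x. T x - z0 *\<^sub>C x) 0"
    from shift[OF this, of "- z0"] show "SVEP_at T z0"
      by (simp add: complex_vector.scale_minus_left)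
  next
    assume "SVEP_at T z0"
    from shift[OF this, of z0] show "SVEP_at (\<lambda>x. T x - z0 *\<^sub>C x) 0" by simp
  qed
qed

lemma gD_upper_semi_Weyl_if_gD_bounded_below:
  fixes T :: "'a::complex_banach \<Rightarrow> 'a"
  assumes T: "bounded_clinear T" and gD: "gD_bounded_below T"
  shows "gD_upper_semi_Weyl T"
proof -
  obtain M N where Red: "(M, N) \<in> Red T" and bb: "bounded_below_on M T" and qn: "quasi_nilpotent_on N T"
    using gD by (auto simp: gD_bounded_below_def)
  have Ms: "complex_vector.subspace M" and Mc: "closed M"
    using Red by (auto simp: Red_def closed_csubspace_def)
  obtain c where c: "c > 0" "\<And>x. x \<in> M \<Longrightarrow> c * norm x \<le> norm (T x)"
    using bb by (auto simp: bounded_below_on_def)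
  have "kernel_on M T = {0}"
    using c complex_vector.subspace_0[OF Ms] bounded_clinear_zero[OF T]
    by (force simp: kernel_on_def mult_le_0_iff)
  moreover have "ext_dim {0::'a} = 0"
  proof -
    have "finite ({} :: 'a set)" "{0} \<subseteq> complex_vector.span ({} :: 'a set)" by simp_all
    moreover have "complex_vector.dim {0::'a} = 0"
      using complex_vector.dim_le_card[of "{0::'a}" "{}"] by simp
    ultimately show ?thesis unfolding ext_dim_def by (metis zero_enat_def)
  qed
  ultimately have ker: "ext_dim (kernel_on M T) = 0" by simp
  have "complete (T ` M)"
    using c(2) Mc
    by (intro complete_isometric_image[OF c(1) csubspace_imp_subspace[OF Ms] bounded_clinear_bounded_linear[OF T]])
      (simp_all add: complete_eq_closed)
  then have "upper_semi_Fredholm_on M T"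
    using ker by (simp add: upper_semi_Fredholm_on_def complete_eq_closed)
  moreover have "index_on M T \<le> 0"
    unfolding index_on_def ker by (cases "ext_codim M (T ` M)") (simp_all add: zero_enat_def)
  ultimately show ?thesis
    unfolding gD_upper_semi_Weyl_def using Red qn by blast
qed

lemma gD_bounded_below_if_gD_upper_semi_Weyl_SVEP:
  fixes T :: "'a::complex_banach \<Rightarrow> 'a"
  assumes T: "bounded_clinear T" and gD: "gD_upper_semi_Weyl T" and SVEP: "SVEP_at T 0"
  shows "gD_bounded_below T"
proof -
  obtain M N where Red: "(M, N) \<in> Red T" and F: "upper_semi_Fredholm_on M T" and qn: "quasi_nilpotent_on N T"
    using gD by (auto simp: gD_upper_semi_Weyl_def)
  then obtain B where "finite B" "kernel_on M T \<subseteq> complex_vector.span B"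
    by (auto simp: upper_semi_Fredholm_on_def ext_dim_def split: if_splits)
  then show ?thesis
    using gD_bounded_below_if_SVEP[OF T SVEP _ Red _ _ qn] F by (simp add: upper_semi_Fredholm_on_def)
qed

theorem proposition2p3:
  fixes T :: "'a::complex_banach \<Rightarrow> 'a"
  assumes "bounded_clinear T"
  shows "sigma_gDM T = sigma_gDWplus T \<longleftrightarrow> (\<forall>z. z \<notin> sigma_gDWplus T \<longrightarrow> SVEP_at T z)"
proof -
  have S: "bounded_clinear (\<lambda>x. T x - z *\<^sub>C x)" for z
    using bounded_clinear_diff_scaleC[OF assms] .
  have "sigma_gDWplus T \<subseteq> sigma_gDM T"
    unfolding sigma_gDM_def sigma_gDWplus_def using gD_upper_semi_Weyl_if_gD_bounded_below[OF S] by blast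
  moreover have "SVEP_at T z" if "z \<notin> sigma_gDM T" for z
    using SVEP_if_gD_bounded_below[OF S[of z]] that
    by (simp add: sigma_gDM_def SVEP_at_shift)
  moreover have "z \<notin> sigma_gDM T" if "z \<notin> sigma_gDWplus T" "SVEP_at T z" for z
    using gD_bounded_below_if_gD_upper_semi_Weyl_SVEP[OF S[of z]] that
    by (simp add: sigma_gDM_def sigma_gDWplus_def SVEP_at_shift)
  ultimately show ?thesis by blast
qed

end
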